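(* Let $K$ be a field and let ${\bf n}=(n_1,n_2,n_3,n_4)$ be a sequence of positive integers with $\gcd(n_1,n_2,n_3,n_4)=1$. For each $i$ let $a_i$ be the least positive integer such that $a_i n_i\in\sum_{j\neq i}\mathbb{N}n_j$. Let $I({\bf n})$ be a complete intersection ideal generated by the binomials $f_1=x_1^{a_1}-x_2^{a_2}$, $f_2=x_3^{a_3}-x_4^{a_4}$ and $f_3=x_1^{u_1}x_2^{u_2}-x_3^{u_3}x_4^{u_4}$, where $u_1,\ldots,u_4\in\mathbb{N}$. Consider the vectors ${\bf d}_1=(0,0,a_2a_4,a_2a_3)$ and ${\bf d}_2=(0,0,a_1a_4,a_1a_3)$. Then there exists a non-negative integer $w_0$ such that for all integers $w\ge w_0$, the monomial curves $C({\bf n}+w{\bf d}_1)$ and $C({\bf n}+w{\bf d}_2)$ have Cohen-Macaulay tangent cones at the origin whenever the entries of the corresponding sequence (${\bf n}+w{\bf d}_1$ for the first family and ${\bf n}+w{\bf d}_2$ for the second) are relatively prime.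
   Context: $\mathbb{N}$ is the set of non-negative integers. For a sequence ${\bf m}=(m_1,\ldots,m_4)$ of positive integers with $\gcd(m_1,\ldots,m_4)=1$, $I({\bf m})$ is the toric ideal, i.e. the kernel of the $K$-algebra homomorphism $K[x_1,\ldots,x_4]\to K[t]$, $x_i\mapsto t^{m_i}$; it has height $3$ and is the defining ideal of the monomial curve $C({\bf m})$ parametrized by $x_i=t^{m_i}$. $I({\bf m})$ is a complete intersection if it can be generated by $3$ elements. For a nonzero polynomial $f$, $f_*$ denotes the homogeneous summand of $f$ of least degree, and $I({\bf m})_*$ is the ideal generated by all $f_*$ with $f\in I({\bf m})$, $f\neq 0$. $C({\bf m})$ has Cohen-Macaulay tangent cone at the origin if the ring $K[x_1,\ldots,x_4]/I({\bf m})_*$ is Cohen-Macaulay. "The entries are relatively prime" means that the greatest common divisor of all four entries is $1$. *)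

theory Defs
  imports
    "HOL-Analysis.Cartesian_Space"
    "HOL-Algebra.Algebraic_Closure_Type"
    "HOL-Algebra.QuotRing"
    "HOL-Library.Poly_Mapping"
    "HOL-Library.Extended_Nat"
    "HOL-Computational_Algebra.Polynomial"
begin

section \<open>Cohen--Macaulay rings\<close>

text \<open>
  For a Noetherian commutative ring, the definition of Eisenbud (Commutative Algebra, Section 18.2)
  and of Kaplansky is used: \<open>R\<close> is Cohen--Macaulay if the depth of every maximal ideal \<open>P\<close>, i.e. the
  supremum of the lengths of the \<open>R\<close>-regular sequences contained in \<open>P\<close>, equals the height of \<open>P\<close>.
\<close>

definition regular_sequence :: "('a, 'b) ring_scheme \<Rightarrow> 'a list \<Rightarrow> bool" where
  "regular_sequence R xs \<longleftrightarrow>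
     set xs \<subseteq> carrier R \<and>
     (\<forall>i<length xs. \<forall>y\<in>carrier R.
        xs ! i \<otimes>\<^bsub>R\<^esub> y \<in> genideal R (set (take i xs)) \<longrightarrow> y \<in> genideal R (set (take i xs))) \<and>
     genideal R (set xs) \<noteq> carrier R"

definition ideal_depth :: "('a, 'b) ring_scheme \<Rightarrow> 'a set \<Rightarrow> enat" where
  "ideal_depth R J = Sup {enat (length xs) | xs. regular_sequence R xs \<and> set xs \<subseteq> J}"

definition prime_height :: "('a, 'b) ring_scheme \<Rightarrow> 'a set \<Rightarrow> enat" where
  "prime_height R P =
     Sup {enat l | l. \<exists>C. (\<forall>i\<le>l. primeideal (C i) R) \<and> (\<forall>i<l. C i \<subset> C (Suc i)) \<and> C l = P}"

definition cohen_macaulay_ring :: "('a, 'b) ring_scheme \<Rightarrow> bool" where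
  "cohen_macaulay_ring R \<longleftrightarrow>
     cring R \<and> noetherian_ring R \<and>
     (\<forall>P. maximalideal P R \<longrightarrow> ideal_depth R P = prime_height R P)"

section \<open>Polynomials in four variables\<close>

text \<open>
  The variables are indexed by the four-element type \<open>4\<close>, whose elements are \<open>1, 2, 3, 4\<close>
  (arithmetic is modulo 4, so that \<open>4 = 0\<close> there). An exponent vector is an element of \<open>4 \<Rightarrow>\<^sub>0 nat\<close>
  and a polynomial maps exponent vectors to coefficients.
\<close>

type_synonym 'k poly4 = "(4 \<Rightarrow>\<^sub>0 nat) \<Rightarrow>\<^sub>0 'k"

definition Var :: "4 \<Rightarrow> 'k::comm_ring_1 poly4" where
  "Var i = Poly_Mapping.single (Poly_Mapping.single i 1) 1"

abbreviation poly4_ring :: "'k::field poly4 ring" where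
  "poly4_ring \<equiv> ring_of_type_algebra"

definition total_degree :: "(4 \<Rightarrow>\<^sub>0 nat) \<Rightarrow> nat" where
  "total_degree e = (\<Sum>i\<in>UNIV. Poly_Mapping.lookup e i)"

definition homogeneous_summand :: "nat \<Rightarrow> 'k::comm_ring_1 poly4 \<Rightarrow> 'k poly4" where
  "homogeneous_summand d f =
     (\<Sum>e\<in>{e \<in> Poly_Mapping.keys f. total_degree e = d}.
        Poly_Mapping.single e (Poly_Mapping.lookup f e))"

text \<open>Only meaningful for \<open>f \<noteq> 0\<close>.\<close>

definition initial_form :: "'k::comm_ring_1 poly4 \<Rightarrow> 'k poly4" where
  "initial_form f = homogeneous_summand (Min (total_degree ` Poly_Mapping.keys f)) f"

definition initial_ideal :: "'k::field poly4 set \<Rightarrow> 'k poly4 set" where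
  "initial_ideal I = genideal poly4_ring {initial_form f | f. f \<in> I \<and> f \<noteq> 0}"

section \<open>Monomial curves\<close>

definition toric_hom :: "(4 \<Rightarrow> nat) \<Rightarrow> 'k::comm_ring_1 poly4 \<Rightarrow> 'k poly" where
  "toric_hom m f =
     (\<Sum>e\<in>Poly_Mapping.keys f.
        smult (Poly_Mapping.lookup f e)
          (\<Prod>i\<in>UNIV. Polynomial.monom 1 (m i) ^ Poly_Mapping.lookup e i))"

definition toric_ideal :: "(4 \<Rightarrow> nat) \<Rightarrow> 'k::field poly4 set" where
  "toric_ideal m = {f. toric_hom m f = 0}"

text \<open>The toric ideal has height 3, so three generators are the least possible number.\<close>

definition complete_intersection :: "'k::field poly4 set \<Rightarrow> bool" where
  "complete_intersection I \<longleftrightarrow> (\<exists>f g h. I = genideal poly4_ring {f, g, h})"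

definition cm_tangent_cone :: "'k::field itself \<Rightarrow> (4 \<Rightarrow> nat) \<Rightarrow> bool" where
  "cm_tangent_cone K m \<longleftrightarrow>
     cohen_macaulay_ring (poly4_ring Quot (initial_ideal (toric_ideal m :: 'k poly4 set)))"

definition least_multiple :: "(4 \<Rightarrow> nat) \<Rightarrow> 4 \<Rightarrow> nat" where
  "least_multiple n i =
     (LEAST a. a > 0 \<and> a * n i \<in> {\<Sum>j\<in>UNIV - {i}. c j * n j | c. True})"

text \<open>
  The explicit formula for \<^const>\<open>toric_hom\<close> is the \<open>K\<close>-algebra homomorphism that sends
  the variable of index \<open>i\<close> to \<open>t ^ m i\<close>.
\<close>

lemma toric_hom_superset:
  assumes "finite A" "Poly_Mapping.keys f \<subseteq> A"
  shows "toric_hom m f = (\<Sum>e\<in>A. smult (Poly_Mapping.lookup f e)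
          (\<Prod>i\<in>UNIV. Polynomial.monom 1 (m i) ^ Poly_Mapping.lookup e i))"
  unfolding toric_hom_def using assms
  by (intro sum.mono_neutral_left) (auto simp: in_keys_iff)

lemma toric_hom_single:
  "toric_hom m (Poly_Mapping.single e c) =
     smult c (\<Prod>i\<in>UNIV. Polynomial.monom 1 (m i) ^ Poly_Mapping.lookup e i)"
  by (subst toric_hom_superset[of "{e}"]) auto

lemma toric_hom_const: "toric_hom m (Poly_Mapping.single 0 c) = [:c:]"
  by (simp add: toric_hom_single)

lemma toric_hom_Var:
  "toric_hom m (Var i :: 'k::comm_ring_1 poly4) = Polynomial.monom 1 (m i)"
proof -
  have "(\<Prod>j\<in>UNIV. Polynomial.monom (1::'k) (m j) ^ Poly_Mapping.lookup (Poly_Mapping.single i 1) j)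
        = (\<Prod>j\<in>UNIV. if j = i then Polynomial.monom 1 (m j) else 1)"
    by (intro prod.cong) (auto simp: lookup_single)
  then show ?thesis
    by (simp add: Var_def toric_hom_single)
qed

lemma toric_hom_add: "toric_hom m (f + g) = toric_hom m f + toric_hom m g"
proof -
  let ?A = "Poly_Mapping.keys f \<union> Poly_Mapping.keys g"
  have "Poly_Mapping.keys (f + g) \<subseteq> ?A" by (rule Poly_Mapping.keys_add)
  then show ?thesis
    by (simp add: toric_hom_superset[of ?A] lookup_add smult_add_left sum.distrib)
qed

lemma toric_hom_mult_single:
  "toric_hom m (Poly_Mapping.single d b * Poly_Mapping.single e c) =
     toric_hom m (Poly_Mapping.single d b) * toric_hom m (Poly_Mapping.single e c)"
  by (simp add: mult_single toric_hom_single lookup_add power_add prod.distrib mult_ac)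

lemma poly_mapping_add_induct [case_names zero add]:
  fixes f :: "'a \<Rightarrow>\<^sub>0 'b::monoid_add"
  assumes "P 0" and "\<And>f e c. P f \<Longrightarrow> P (f + Poly_Mapping.single e c)"
  shows "P f"
proof (induction f rule: Poly_Mapping.update_induct)
  case const
  show ?case by (rule assms(1))
next
  case (update f e c)
  have "Poly_Mapping.update e c f = f + Poly_Mapping.single e c"
    using update(1)
    by (intro poly_mapping_eqI) (auto simp: lookup_update lookup_add lookup_single in_keys_iff)
  with update assms(2) show ?case by simp
qed

lemma toric_hom_mult: "toric_hom m (f * g) = toric_hom m f * toric_hom m g"
proof (induction f rule: poly_mapping_add_induct)
  case zero
  show ?case by (simp add: toric_hom_def)
next
  case (add f d b)
  have "toric_hom m (Poly_Mapping.single d b * g) = toric_hom m (Poly_Mapping.single d b) * toric_hom m g"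
  proof (induction g rule: poly_mapping_add_induct)
    case zero
    show ?case by (simp add: toric_hom_def)
  next
    case (add g e c)
    then show ?case by (simp add: toric_hom_add distrib_left toric_hom_mult_single)
  qed
  with add show ?case by (simp add: toric_hom_add distrib_right)
qed

end

theory Submission
  imports Defs
begin

text \<open>
  Every sequence in either family has the form \<open>m = (a\<^sub>2P, a\<^sub>1P, a\<^sub>4Q, a\<^sub>3Q)\<close> with \<open>a\<^sub>1, a\<^sub>2\<close> coprime,
  \<open>P, Q\<close> coprime, \<open>P\<close> fixed and \<open>Q\<close> growing with \<open>w\<close>. Let \<open>m\<^sub>b\<close> be the least entry. For large \<open>Q\<close>, a
  monomial that has maximal total degree among those of its weight keeps this property after multiplication by
  \<open>x\<^sub>b\<close>. This stability makes the tangent cone Cohen--Macaulay: filter the polynomial ring by the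
  excess \<open>\<Sum> (m\<^sub>i - m\<^sub>b) e\<^sub>i\<close>. The ideal of initial forms consists of the polynomials all of whose layers, the
  parts of given excess with non-maximal monomials discarded, vanish in \<open>K[t]\<close>, and the layer of excess \<open>0\<close>
  is a ring homomorphism onto \<open>K[t]\<close> that acts on the lowest layer of any polynomial. Hence the initial
  ideal is primary with a radical whose quotient is \<open>K[t]\<close>, so every maximal ideal of the tangent cone has
  depth and height \<open>1\<close>.
\<close>

section \<open>Rings that are primary over a polynomial ring\<close>

text \<open>Division with remainder by a nonzero element of least degree. Only closure properties
  are assumed, so that the lemma applies to images under maps such as \<open>layer j\<close>, which
  need not be ring homomorphisms.\<close>

lemma poly_ideal_principal:
  fixes M :: "'k::field poly set"
  assumes "0 \<in> M" "\<And>p q. p \<in> M \<Longrightarrow> q \<in> M \<Longrightarrow> p + q \<in> M" "\<And>p q. q \<in> M \<Longrightarrow> p * q \<in> M"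
  shows "\<exists>p. \<forall>q. q \<in> M \<longleftrightarrow> p dvd q"
proof (cases "M = {0}")
  case True
  then show ?thesis by (auto intro!: exI[of _ 0])
next
  case False
  then have ex: "\<exists>p. p \<in> M \<and> p \<noteq> 0" using assms(1) by blast
  define p where "p = (ARG_MIN degree p. p \<in> M \<and> p \<noteq> 0)"
  have p: "p \<in> M" "p \<noteq> 0"
    using arg_min_natI[of "\<lambda>p. p \<in> M \<and> p \<noteq> 0" _ degree] ex unfolding p_def by blast+
  have min: "degree p \<le> degree q" if "q \<in> M" "q \<noteq> 0" for q
    using arg_min_nat_le[of "\<lambda>p. p \<in> M \<and> p \<noteq> 0" q degree] that unfolding p_def by blast
  have "p dvd q" if "q \<in> M" for q
  proof -
    have "q mod p = q + (- (q div p)) * p" by (simp add: minus_div_mult_eq_mod [symmetric])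
    then have "q mod p \<in> M" using assms(2)[OF that assms(3)[OF p(1)]] by metis
    then show ?thesis using min[of "q mod p"] degree_mod_less'[of p q] p(2)
      by (metis mod_eq_0_iff_dvd not_le)
  qed
  moreover have "q \<in> M" if "p dvd q" for q
    using that assms(3)[OF p(1)] by (metis dvd_def mult.commute)
  ultimately show ?thesis by blast
qed

lemma poly_power_decomposition:
  fixes f p :: "'k::field poly"
  assumes "f \<noteq> 0" "\<not> p dvd 1"
  shows "\<exists>k q. f = p ^ k * q \<and> \<not> p dvd q"
  using assms(1)
proof (induction "degree f" arbitrary: f rule: less_induct)
  case less
  show ?case
  proof (cases "p dvd f")
    case False
    then show ?thesis by (intro exI[of _ 0] exI[of _ f]) simp
  next
    case True
    then obtain g where g: "f = p * g" by (rule dvdE)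
    then have "p \<noteq> 0" "g \<noteq> 0" using less.prems by auto
    then have "degree p > 0" using assms(2) by (simp add: is_unit_iff_degree)
    then have "degree g < degree f" using g \<open>p \<noteq> 0\<close> \<open>g \<noteq> 0\<close> by (simp add: degree_mult_eq)
    then obtain k q where kq: "g = p ^ k * q" "\<not> p dvd q" using less.hyps \<open>g \<noteq> 0\<close> by blast
    then have "f = p ^ Suc k * q" using g by (simp add: mult_ac)
    then show ?thesis using kq(2) by blast
  qed
qed

text \<open>The axioms make \<open>0\<close> a primary ideal whose radical, the kernel of
  \<open>\<psi>\<close>, has quotient \<open>K[t]\<close>. The tangent cone will be shown to have
  this form.\<close>

locale ring_over_polys = cring R for R :: "('a, 'b) ring_scheme" (structure) +
  fixes \<psi> :: "'a \<Rightarrow> 'k::field poly"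
  assumes psi_add: "\<And>x y. x \<in> carrier R \<Longrightarrow> y \<in> carrier R \<Longrightarrow> \<psi> (x \<oplus> y) = \<psi> x + \<psi> y"
    and psi_mult: "\<And>x y. x \<in> carrier R \<Longrightarrow> y \<in> carrier R \<Longrightarrow> \<psi> (x \<otimes> y) = \<psi> x * \<psi> y"
    and psi_one: "\<psi> \<one> = 1"
    and psi_surj: "\<And>p. \<exists>x\<in>carrier R. \<psi> x = p"
    and nilpotent: "\<And>x. x \<in> carrier R \<Longrightarrow> \<psi> x = 0 \<Longrightarrow> \<exists>n. x [^] (n::nat) = \<zero>"
    and regular: "\<And>x y. x \<in> carrier R \<Longrightarrow> y \<in> carrier R \<Longrightarrow> \<psi> x \<noteq> 0 \<Longrightarrow> x \<otimes> y = \<zero> \<Longrightarrow> y = \<zero>"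
begin

section \<open>Ideals and primes read off from their images in \<open>K[t]\<close>\<close>

lemma psi_zero [simp]: "\<psi> \<zero> = 0"
  using psi_add[of \<zero> \<zero>] by (metis add_cancel_left_left r_zero zero_closed)

lemma psi_minus: "x \<in> carrier R \<Longrightarrow> y \<in> carrier R \<Longrightarrow> \<psi> (x \<ominus> y) = \<psi> x - \<psi> y"
  using psi_add[of "x \<ominus> y" y] by (simp add: a_minus_def a_assoc l_neg)

lemma psi_pow: "x \<in> carrier R \<Longrightarrow> \<psi> (x [^] (n::nat)) = \<psi> x ^ n"
  by (induction n) (simp_all add: psi_one psi_mult mult.commute)

lemma one_not_zero: "\<one> \<noteq> \<zero>"
  using psi_one psi_zero by (metis one_neq_zero)

lemma pow_in_prime:
  assumes "primeideal P R" "x \<in> carrier R" "x [^] (n::nat) \<in> P"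
  shows "x \<in> P"
  using assms(3)
proof (induction n)
  case 0
  then show ?case using assms(1) ideal.one_imp_carrier primeideal.I_notcarr primeideal.axioms(1)
    by (metis nat_pow_0)
next
  case (Suc n)
  then show ?case using primeideal.I_prime[OF assms(1), of "x [^] n" x] assms(2) by auto
qed

lemma kernel_in_prime:
  assumes "primeideal P R" "x \<in> carrier R" "\<psi> x = 0"
  shows "x \<in> P"
  using pow_in_prime[OF assms(1,2)] nilpotent[OF assms(2,3)] assms(1)
  by (metis additive_subgroup.zero_closed ideal.axioms(1) primeideal.axioms(1))

text \<open>If \<open>\<psi> x = \<psi> y\<close> with \<open>y \<in> J\<close>, then
  \<open>x \<ominus> y\<close> lies in the kernel and hence in \<open>J\<close>. So \<open>J\<close>
  is determined by its image, an ideal of \<open>K[t]\<close> and therefore principal.\<close>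

lemma ideal_generator:
  assumes "ideal J R" and ker: "\<And>x. x \<in> carrier R \<Longrightarrow> \<psi> x = 0 \<Longrightarrow> x \<in> J"
  obtains p where "\<And>x. x \<in> carrier R \<Longrightarrow> x \<in> J \<longleftrightarrow> p dvd \<psi> x"
proof -
  interpret J: ideal J R by fact
  have "\<exists>p. \<forall>q. q \<in> \<psi> ` J \<longleftrightarrow> p dvd q"
  proof (rule poly_ideal_principal)
    show "0 \<in> \<psi> ` J" by (metis J.zero_closed image_eqI psi_zero)
    show "p + q \<in> \<psi> ` J" if "p \<in> \<psi> ` J" "q \<in> \<psi> ` J" for p q
      using that J.a_closed J.Icarr psi_add by (smt (verit) image_iff)
    show "p * q \<in> \<psi> ` J" if "q \<in> \<psi> ` J" for p q
      using that psi_surj[of p] J.I_l_closed J.Icarr psi_mult by (smt (verit) image_iff)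
  qed
  then obtain p where p: "\<And>q. q \<in> \<psi> ` J \<longleftrightarrow> p dvd q" by blast
  have J: "x \<in> J" if x: "x \<in> carrier R" "\<psi> x \<in> \<psi> ` J" for x
  proof -
    obtain y where y: "y \<in> J" "\<psi> x = \<psi> y" using x by blast
    then have "x \<ominus> y \<in> J" using psi_minus[of x y] x J.Icarr by (intro ker) auto
    then have "(x \<ominus> y) \<oplus> y \<in> J" using y J.a_closed by blast
    then show ?thesis using x y(1) J.Icarr by (simp add: a_minus_def a_assoc l_neg)
  qed
  have "x \<in> J \<longleftrightarrow> p dvd \<psi> x" if "x \<in> carrier R" for x
    using J[OF that] p[of "\<psi> x"] by auto
  then show ?thesis by (rule that)
qed

text \<open>Primes contain all nilpotent elements, hence the kernel, so
  \<open>ideal_generator\<close> applies. The generator may be \<open>0\<close>, as it is for the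
  kernel itself.\<close>

lemma prime_generator:
  assumes "primeideal P R"
  obtains p where "\<And>x. x \<in> carrier R \<Longrightarrow> x \<in> P \<longleftrightarrow> p dvd \<psi> x"
    and "\<not> p dvd 1" and "\<And>q r. p dvd q * r \<Longrightarrow> p dvd q \<or> p dvd r"
proof -
  interpret P: primeideal P R by fact
  obtain p where p: "\<And>x. x \<in> carrier R \<Longrightarrow> x \<in> P \<longleftrightarrow> p dvd \<psi> x"
    using ideal_generator[OF P.is_ideal kernel_in_prime[OF assms]] by blast
  have "\<not> p dvd 1" using p[of \<one>] P.I_notcarr P.one_imp_carrier psi_one by auto
  moreover have "p dvd q \<or> p dvd r" if qr: "p dvd q * r" for q r
  proof -
    obtain x y where xy: "x \<in> carrier R" "y \<in> carrier R" "\<psi> x = q" "\<psi> y = r"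
      using psi_surj by meson
    then have "x \<otimes> y \<in> P" using p[of "x \<otimes> y"] qr by (simp add: psi_mult)
    then show ?thesis using P.I_prime p xy by blast
  qed
  ultimately show ?thesis using that p by blast
qed

text \<open>\<open>\<psi> x \<noteq> 0\<close> makes the generator of \<open>P\<close> a nonzero
  prime element of \<open>K[t]\<close>, which has no proper nonunit divisor; the generator of
  \<open>P'\<close> would be one.\<close>

lemma prime_chain:
  assumes P: "primeideal P R" and P': "primeideal P' R" and "P \<subset> P'" and "x \<in> P" "\<psi> x \<noteq> 0"
  shows False
proof -
  obtain p where p: "\<And>x. x \<in> carrier R \<Longrightarrow> x \<in> P \<longleftrightarrow> p dvd \<psi> x"
    and p_prime: "\<And>q r. p dvd q * r \<Longrightarrow> p dvd q \<or> p dvd r"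
    using prime_generator[OF P] by metis
  obtain p' where p': "\<And>x. x \<in> carrier R \<Longrightarrow> x \<in> P' \<longleftrightarrow> p' dvd \<psi> x" and unit: "\<not> p' dvd 1"
    using prime_generator[OF P'] by metis
  have carr: "P \<subseteq> carrier R" "P' \<subseteq> carrier R"
    using ideal.Icarr[OF primeideal.axioms(1)[OF P]] ideal.Icarr[OF primeideal.axioms(1)[OF P']] by auto
  have "p \<noteq> 0" using assms(4,5) p[of x] carr by auto
  have "p' dvd p"
  proof -
    obtain z where z: "z \<in> carrier R" "\<psi> z = p" using psi_surj by blast
    then have "z \<in> P'" using p[of z] assms(3) by auto
    then show ?thesis using p'[of z] z by simp
  qed
  then obtain h where h: "p = p' * h" by blast
  then consider "p dvd p'" | "p dvd h" using p_prime[of p' h] by auto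
  then show False
  proof cases
    case 1
    have "y \<in> P" if "y \<in> P'" for y
    proof -
      have "y \<in> carrier R" using that carr by blast
      then show ?thesis using p[of y] p'[of y] that 1 dvd_trans by simp
    qed
    then show False using assms(3) by blast
  next
    case 2
    then obtain k where "h = p * k" by (rule dvdE)
    then have "p = p' * (p * k)" using h by simp
    then have "p * (p' * k) = p * 1" by (simp add: mult_ac)
    then show False using \<open>p \<noteq> 0\<close> unit by (metis dvd_triv_left mult_cancel_left)
  qed
qed

lemma ideal_vimage: "ideal {x \<in> carrier R. p dvd \<psi> x} R"
proof (rule idealI)
  show "subgroup {x \<in> carrier R. p dvd \<psi> x} (add_monoid R)"
  proof (rule add.subgroupI)
    fix x assume x: "x \<in> {x \<in> carrier R. p dvd \<psi> x}"
    then have "\<psi> (\<ominus> x) = - \<psi> x" using psi_minus[of \<zero> x] by (simp add: a_minus_def)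
    then show "\<ominus> x \<in> {x \<in> carrier R. p dvd \<psi> x}" using x by simp
  next
    show "{x \<in> carrier R. p dvd \<psi> x} \<noteq> {}" using psi_zero by force
  qed (auto simp: psi_add)
qed (auto simp: psi_mult ring_axioms)

lemma kernel_prime: "primeideal {x \<in> carrier R. \<psi> x = 0} R"
proof (rule primeidealI)
  show "ideal {x \<in> carrier R. \<psi> x = 0} R" using ideal_vimage[of 0] by simp
  show "carrier R \<noteq> {x \<in> carrier R. \<psi> x = 0}" using psi_one one_closed by (metis (mono_tags, lifting) mem_Collect_eq one_neq_zero)
qed (auto simp: psi_mult is_cring)

text \<open>\<open>K[t]\<close> is not a field: the preimage of the ideal \<open>(t)\<close> is
  proper and strictly larger than any ideal inside the kernel.\<close>

lemma maximal_not_kernel: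
  assumes "maximalideal P R"
  obtains x where "x \<in> P" "\<psi> x \<noteq> 0"
proof (rule ccontr)
  interpret P: maximalideal P R by fact
  assume "\<not> thesis"
  then have sub: "P \<subseteq> {x \<in> carrier R. \<psi> x = 0}" using that P.Icarr by blast
  define t :: "'k poly" where "t = [:0, 1:]"
  have t: "\<not> t dvd 1" "t \<noteq> 0" by (simp_all add: t_def is_unit_iff_degree)
  define J where "J = {x \<in> carrier R. t dvd \<psi> x}"
  obtain z where z: "z \<in> carrier R" "\<psi> z = t" using psi_surj by blast
  have "P \<subseteq> J" using sub by (auto simp: J_def)
  moreover have "J \<subseteq> carrier R" by (auto simp: J_def)
  ultimately have "J = P \<or> J = carrier R"
    using P.I_maximal[of J] ideal_vimage[of t] J_def by blast
  moreover have "z \<in> J" using z by (simp add: J_def)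
  moreover have "z \<notin> P" using sub z t by auto
  moreover have "\<one> \<notin> J" using psi_one t by (simp add: J_def)
  ultimately show False using one_closed by metis
qed

section \<open>Height of the maximal ideals\<close>

lemma height_maximal:
  assumes max: "maximalideal P R"
  shows "prime_height R P = 1"
proof -
  have P: "primeideal P R" using max maximalideal_prime by blast
  obtain x where x: "x \<in> P" "\<psi> x \<noteq> 0" using maximal_not_kernel[OF max] .
  let ?K = "{x \<in> carrier R. \<psi> x = 0}"
  have K: "?K \<subset> P" using kernel_in_prime[OF P] x by blast
  have "1 \<le> prime_height R P"
    unfolding prime_height_def
  proof (intro Sup_upper CollectI exI conjI)
    let ?C = "\<lambda>i::nat. if i = 0 then ?K else P"
    show "1 = enat 1" by (simp add: one_enat_def)
    show "\<forall>i\<le>1. primeideal (?C i) R" using P kernel_prime by simp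
    show "\<forall>i<1. ?C i \<subset> ?C (Suc i)" using K by simp
    show "?C 1 = P" by simp
  qed
  moreover have "prime_height R P \<le> 1"
    unfolding prime_height_def
  proof (intro Sup_least, clarify)
    fix l and C :: "nat \<Rightarrow> 'a set"
    assume C: "\<forall>i\<le>l. primeideal (C i) R" "\<forall>i<l. C i \<subset> C (Suc i)"
    show "enat l \<le> 1"
    proof (rule ccontr)
      assume "\<not> enat l \<le> 1"
      then have l: "l \<ge> 2" by (simp add: one_enat_def)
      \<comment> \<open>The middle prime has an element outside \<open>C 0\<close>, hence outside
        the kernel, and then \<open>prime_chain\<close> forbids the step to
        \<open>C 2\<close>.\<close>
      have sub: "C 0 \<subset> C 1" "C 1 \<subset> C 2" using C(2) l by (auto simp: numeral_2_eq_2)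
      have pr: "primeideal (C 0) R" "primeideal (C 1) R" "primeideal (C 2) R" using C(1) l by auto
      obtain y where y: "y \<in> C 1" "y \<notin> C 0" using sub by blast
      have "y \<in> carrier R" using ideal.Icarr[OF primeideal.axioms(1)[OF pr(2)] y(1)] .
      then have "\<psi> y \<noteq> 0" using kernel_in_prime[OF pr(1)] y by blast
      then show False using prime_chain[OF pr(2,3) sub(2) y(1)] by blast
    qed
  qed
  ultimately show ?thesis by simp
qed

section \<open>Depth of the maximal ideals\<close>

lemma Idl_empty: "Idl {} = {\<zero>}"
  using genideal_minimal[OF zeroideal, of "{}"] additive_subgroup.zero_closed[OF ideal.axioms(1)[OF genideal_ideal[of "{}"]]]
  by blast

text \<open>Congruences modulo an ideal are multiplicative. Applied to an element congruent to a
  nilpotent one, this puts a power of it into \<open>J\<close>.\<close>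

lemma pow_diff_mem:
  assumes J: "ideal J R" and xy: "x \<in> carrier R" "y \<in> carrier R" "x \<ominus> y \<in> J"
  shows "x [^] (n::nat) \<ominus> y [^] n \<in> J"
proof (induction n)
  case 0
  then show ?case using additive_subgroup.zero_closed[OF ideal.axioms(1)[OF J]] by (simp add: a_minus_def r_neg)
next
  case (Suc n)
  have "x [^] Suc n \<ominus> y [^] Suc n = x [^] n \<otimes> (x \<ominus> y) \<oplus> (x [^] n \<ominus> y [^] n) \<otimes> y"
  proof -
    define a b where "a = x [^] n" and "b = y [^] n"
    have "a \<in> carrier R" "b \<in> carrier R" using xy by (auto simp: a_def b_def)
    then have "a \<otimes> x \<ominus> b \<otimes> y = a \<otimes> (x \<ominus> y) \<oplus> (a \<ominus> b) \<otimes> y" using xy by algebra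
    then show ?thesis by (simp add: a_def b_def)
  qed
  then show ?case using Suc J xy
    by (simp add: ideal.I_l_closed ideal.I_r_closed additive_subgroup.a_closed ideal.axioms(1))
qed

lemma regular_power:
  assumes J: "ideal J R" and g: "g \<in> carrier R" "\<And>y. y \<in> carrier R \<Longrightarrow> g \<otimes> y \<in> J \<Longrightarrow> y \<in> J"
    and "y \<in> carrier R" "g [^] (n::nat) \<otimes> y \<in> J"
  shows "y \<in> J"
  using assms(5)
proof (induction n)
  case 0
  then show ?case using assms(4) by simp
next
  case (Suc n)
  then have "g \<otimes> (g [^] n \<otimes> y) \<in> J" using g(1) assms(4) by (simp add: m_ac)
  then have "g [^] n \<otimes> y \<in> J" using g(1) assms(4) g(2)[of "g [^] n \<otimes> y"] by blast
  then show ?case by (rule Suc.IH)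
qed

text \<open>If \<open>f, g \<in> P\<close> and \<open>\<psi> f = p ^ k * q\<close> with \<open>p\<close> not dividing \<open>q\<close>, then \<open>g ^ k * q\<close> is a
  multiple of \<open>f\<close> up to a nilpotent element; so if \<open>g\<close> were regular modulo \<open>f\<close>, then \<open>f\<close> would
  divide a power of \<open>q\<close>.\<close>
lemma regular_sequence_length:
  assumes max: "maximalideal P R" and xs: "regular_sequence R xs" "set xs \<subseteq> P"
  shows "length xs \<le> 1"
proof (rule ccontr)
  assume len: "\<not> length xs \<le> 1"
  have P: "primeideal P R" using max maximalideal_prime by blast
  obtain p where p: "\<And>x. x \<in> carrier R \<Longrightarrow> x \<in> P \<longleftrightarrow> p dvd \<psi> x" and unit: "\<not> p dvd 1"
    and prime: "\<And>q r. p dvd q * r \<Longrightarrow> p dvd q \<or> p dvd r"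
    using prime_generator[OF P] by metis
  define f g where "f = xs ! 0" and "g = xs ! 1"
  have "0 < length xs" "1 < length xs" using len by linarith+
  then have fg: "f \<in> set xs" "g \<in> set xs" unfolding f_def g_def by (blast intro: nth_mem)+
  have carr: "f \<in> carrier R" "g \<in> carrier R" using fg xs by (auto simp: regular_sequence_def)
  have dvd: "p dvd \<psi> f" "p dvd \<psi> g" using p[of f] p[of g] carr fg xs(2) by auto
  have take1: "set (take 1 xs) = {f}" using len by (cases xs) (auto simp: f_def)
  have reg: "y \<in> Idl (set (take i xs))"
    if "i < length xs" "y \<in> carrier R" "xs ! i \<otimes> y \<in> Idl (set (take i xs))" for i y
    using xs(1) that unfolding regular_sequence_def by blast
  have f_reg: "y = \<zero>" if "y \<in> carrier R" "f \<otimes> y = \<zero>" for y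
    using reg[of 0 y] len that Idl_empty by (cases xs) (auto simp: f_def)
  have g_reg: "y \<in> Idl {f}" if "y \<in> carrier R" "g \<otimes> y \<in> Idl {f}" for y
    using reg[of 1 y] len that take1 by (simp add: g_def)
  have J: "ideal (Idl {f}) R" using genideal_ideal carr by simp
  have J0: "\<zero> \<in> Idl {f}" using J additive_subgroup.zero_closed ideal.axioms(1) by blast
  have fJ: "f \<in> Idl {f}" using genideal_self' carr by blast
  have J_dvd: "\<psi> f dvd \<psi> y" if "y \<in> Idl {f}" for y
    using genideal_minimal[OF ideal_vimage[of "\<psi> f"], of "{f}"] that carr by auto
  \<comment> \<open>Elements of the kernel are nilpotent, whereas no power of the nonzerodivisor
    \<open>f\<close> vanishes.\<close>
  have f0: "\<psi> f \<noteq> 0"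
  proof
    assume "\<psi> f = 0"
    then obtain n where n: "f [^] (n::nat) = \<zero>" using nilpotent carr by blast
    have "f [^] (m::nat) \<noteq> \<zero>" for m
    proof (induction m)
      case (Suc m)
      then show ?case using f_reg[of "f [^] m"] carr m_comm[of f "f [^] m"] by auto
    qed (simp add: one_not_zero)
    then show False using n by blast
  qed
  obtain k q where kq: "\<psi> f = p ^ k * q" "\<not> p dvd q"
    using poly_power_decomposition[OF f0 unit] by blast
  obtain r where r: "\<psi> g = p * r" using dvd(2) by (rule dvdE)
  obtain Q S where QS: "Q \<in> carrier R" "\<psi> Q = q" "S \<in> carrier R" "\<psi> S = r ^ k"
    using psi_surj by meson
  \<comment> \<open>Both \<open>a\<close> and \<open>S \<otimes> f\<close> have image
    \<open>p ^ k * r ^ k * q\<close>, so \<open>z\<close> lies in the kernel.\<close>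
  define a z where "a = g [^] k \<otimes> Q" and "z = a \<ominus> S \<otimes> f"
  have az: "a \<in> carrier R" "z \<in> carrier R" using carr QS by (auto simp: a_def z_def)
  have "\<psi> z = 0"
    using carr QS az unfolding z_def
    by (simp add: psi_minus psi_mult a_def psi_pow kq r power_mult_distrib)
  then obtain N where N: "z [^] (N::nat) = \<zero>" using nilpotent az by blast
  have "a \<ominus> z = S \<otimes> f" unfolding z_def using az(1) QS carr by algebra
  then have "a \<ominus> z \<in> Idl {f}" using fJ J QS ideal.I_l_closed by metis
  then have "a [^] N \<ominus> z [^] N \<in> Idl {f}" using pow_diff_mem[OF J az] by blast
  then have "a [^] N \<in> Idl {f}" using N az by (simp add: a_minus_def)
  moreover have "a [^] N = g [^] (k * N) \<otimes> Q [^] N"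
    unfolding a_def using carr QS by (simp add: nat_pow_distrib nat_pow_pow)
  ultimately have "Q [^] N \<in> Idl {f}"
    using regular_power[OF J carr(2) g_reg, of "Q [^] N"] QS by simp
  then have "\<psi> f dvd q ^ N" using J_dvd psi_pow QS by metis
  then have "p dvd q ^ N" using dvd dvd_trans by blast
  then have "p dvd q"
  proof (induction N)
    case (Suc N)
    then show ?case using prime[of q "q ^ N"] by auto
  qed (use unit in simp)
  then show False using kq by blast
qed

text \<open>An element of \<open>P\<close> outside the kernel is a nonzerodivisor and forms a
  regular sequence of length one; longer ones are excluded by
  \<open>regular_sequence_length\<close>.\<close>

lemma depth_maximal:
  assumes max: "maximalideal P R"
  shows "ideal_depth R P = 1"
proof -
  obtain x where x: "x \<in> P" "\<psi> x \<noteq> 0" using maximal_not_kernel[OF max] .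
  interpret P: maximalideal P R by fact
  have "regular_sequence R [x]"
    unfolding regular_sequence_def
  proof (intro conjI allI impI ballI)
    show "set [x] \<subseteq> carrier R" using x P.Icarr by simp
    show "Idl (set [x]) \<noteq> carrier R"
      using genideal_minimal[OF P.is_ideal, of "{x}"] x P.I_notcarr P.a_subset by auto
    show "y \<in> Idl (set (take i [x]))"
      if "i < length [x]" "y \<in> carrier R" "[x] ! i \<otimes> y \<in> Idl (set (take i [x]))" for i y
      using that regular[of x y] x P.Icarr by (simp add: Idl_empty)
  qed
  then have "1 \<le> ideal_depth R P"
    unfolding ideal_depth_def using x
    by (intro Sup_upper) (auto intro!: exI[of _ "[x]"] simp: one_enat_def)
  moreover have "ideal_depth R P \<le> 1"
    unfolding ideal_depth_def using regular_sequence_length[OF max]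
    by (intro Sup_least) (auto simp: one_enat_def)
  ultimately show ?thesis by simp
qed

theorem cohen_macaulay:
  assumes "noetherian_ring R"
  shows "cohen_macaulay_ring R"
  using assms is_cring height_maximal depth_maximal unfolding cohen_macaulay_ring_def by simp

end

section \<open>The initial ideal under stable maximal degrees\<close>

lemma poly_mapping_expansion: "f = (\<Sum>e\<in>Poly_Mapping.keys f. Poly_Mapping.single e (Poly_Mapping.lookup f e))"
  by (rule poly_mapping_eqI) (auto simp: lookup_sum lookup_single when_def in_keys_iff)

text \<open>The \<open>K\<close>-linear extension of a map from monomials to \<open>K[t]\<close>.
  \<open>toric_hom\<close>, \<open>layer\<close> and \<open>base\<close> are all of this
  kind.\<close>

definition lin_ext :: "('a \<Rightarrow> 'k poly) \<Rightarrow> ('a \<Rightarrow>\<^sub>0 'k::comm_ring_1) \<Rightarrow> 'k poly" where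
  "lin_ext g f = (\<Sum>e\<in>Poly_Mapping.keys f. smult (Poly_Mapping.lookup f e) (g e))"

lemma lin_ext_superset:
  assumes "finite A" "Poly_Mapping.keys f \<subseteq> A"
  shows "lin_ext g f = (\<Sum>e\<in>A. smult (Poly_Mapping.lookup f e) (g e))"
  unfolding lin_ext_def using assms
  by (intro sum.mono_neutral_left) (auto simp: in_keys_iff)

lemma lin_ext_zero [simp]: "lin_ext g 0 = 0"
  by (simp add: lin_ext_def)

lemma lin_ext_single: "lin_ext g (Poly_Mapping.single e c) = smult c (g e)"
  by (subst lin_ext_superset[of "{e}"]) auto

lemma lin_ext_add: "lin_ext g (f + f') = lin_ext g f + lin_ext g f'"
proof -
  let ?A = "Poly_Mapping.keys f \<union> Poly_Mapping.keys f'"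
  have "Poly_Mapping.keys (f + f') \<subseteq> ?A" by (rule Poly_Mapping.keys_add)
  then show ?thesis
    by (simp add: lin_ext_superset[of ?A] lookup_add smult_add_left sum.distrib)
qed

lemma lin_ext_diff: "lin_ext g (f - f') = lin_ext g f - lin_ext g f'"
  using lin_ext_add[of g "f - f'" f'] by simp

lemma lin_ext_sum: "lin_ext g (sum F A) = (\<Sum>x\<in>A. lin_ext g (F x))"
  by (induction A rule: infinite_finite_induct) (simp_all add: lin_ext_add)

text \<open>Three different maps are allowed because a layer of a product mixes \<open>base\<close>
  and \<open>layer\<close>. The condition is imposed on keys only, so that it can exploit a lower
  bound on the excess of one factor.\<close>

lemma lin_ext_mult:
  fixes y z :: "'a::monoid_add \<Rightarrow>\<^sub>0 'k::comm_ring_1"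
  assumes "\<And>d e. d \<in> Poly_Mapping.keys y \<Longrightarrow> e \<in> Poly_Mapping.keys z \<Longrightarrow> g (d + e) = h d * k e"
  shows "lin_ext g (y * z) = lin_ext h y * lin_ext k z"
proof -
  have "y * z = (\<Sum>d\<in>Poly_Mapping.keys y. Poly_Mapping.single d (Poly_Mapping.lookup y d)) *
      (\<Sum>e\<in>Poly_Mapping.keys z. Poly_Mapping.single e (Poly_Mapping.lookup z e))"
    using poly_mapping_expansion[of y] poly_mapping_expansion[of z] by simp
  then have "lin_ext g (y * z) = (\<Sum>d\<in>Poly_Mapping.keys y. \<Sum>e\<in>Poly_Mapping.keys z.
      smult (Poly_Mapping.lookup y d * Poly_Mapping.lookup z e) (g (d + e)))"
    by (simp add: sum_product mult_single lin_ext_sum lin_ext_single)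
  also have "\<dots> = (\<Sum>d\<in>Poly_Mapping.keys y. \<Sum>e\<in>Poly_Mapping.keys z.
      smult (Poly_Mapping.lookup y d) (h d) * smult (Poly_Mapping.lookup z e) (k e))"
    by (intro sum.cong refl) (simp add: assms mult_ac)
  finally show ?thesis by (simp add: lin_ext_def sum_product)
qed

section \<open>Weights, total degrees and initial forms\<close>

definition weight :: "(4 \<Rightarrow> nat) \<Rightarrow> (4 \<Rightarrow>\<^sub>0 nat) \<Rightarrow> nat" where
  "weight m e = (\<Sum>i\<in>UNIV. m i * Poly_Mapping.lookup e i)"

lemma weight_add: "weight m (d + e) = weight m d + weight m e"
  by (simp add: weight_def lookup_add distrib_left sum.distrib)

lemma total_degree_add: "total_degree (d + e) = total_degree d + total_degree e"
  by (simp add: total_degree_def lookup_add sum.distrib)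

lemma weight_single: "weight m (Poly_Mapping.single i n) = m i * n"
  by (simp add: weight_def lookup_single when_def if_distrib cong: if_cong)

lemma total_degree_single: "total_degree (Poly_Mapping.single i n) = n"
  by (simp add: total_degree_def lookup_single when_def)

lemma prod_monom: "(\<Prod>i\<in>A. Polynomial.monom (1::'k::comm_ring_1) (n i)) = Polynomial.monom 1 (\<Sum>i\<in>A. n i)"
  by (induction A rule: infinite_finite_induct) (simp_all add: mult_monom)

lemma toric_hom_eq_lin_ext: "toric_hom m = lin_ext (\<lambda>e. Polynomial.monom 1 (weight m e))"
  by (rule ext) (simp add: toric_hom_def lin_ext_def weight_def monom_power prod_monom)

lemma coeff_lin_ext_monom:
  "coeff (lin_ext (\<lambda>e. if A e then Polynomial.monom 1 (n e) else 0) f) k =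
     (\<Sum>e\<in>Poly_Mapping.keys f. if A e \<and> n e = k then Poly_Mapping.lookup f e else 0)"
  unfolding lin_ext_def coeff_sum by (intro sum.cong) auto

lemma lookup_homogeneous_summand:
  "Poly_Mapping.lookup (homogeneous_summand d f) e =
     (if total_degree e = d then Poly_Mapping.lookup f e else 0)"
proof -
  have "Poly_Mapping.lookup (homogeneous_summand d f) e =
     (\<Sum>e'\<in>{e \<in> Poly_Mapping.keys f. total_degree e = d}. if e' = e then Poly_Mapping.lookup f e else 0)"
    unfolding homogeneous_summand_def lookup_sum
    by (intro sum.cong) (auto simp: lookup_single when_def)
  then show ?thesis by (auto simp: in_keys_iff)
qed

text \<open>The initial forms of such binomials in the toric ideal turn out to generate the whole
  initial ideal.\<close>

lemma initial_form_single_diff: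
  fixes e e' :: "4 \<Rightarrow>\<^sub>0 nat"
  assumes "total_degree e \<le> total_degree e'" "e \<noteq> e'"
  shows "initial_form (Poly_Mapping.single e 1 - Poly_Mapping.single e' (1::'k::comm_ring_1)) =
    (if total_degree e < total_degree e' then Poly_Mapping.single e 1
     else Poly_Mapping.single e 1 - Poly_Mapping.single e' 1)"
proof -
  let ?f = "Poly_Mapping.single e 1 - Poly_Mapping.single e' (1::'k)"
  have "Poly_Mapping.keys ?f = {e, e'}"
    using assms(2) by (auto simp: in_keys_iff lookup_minus lookup_single when_def split: if_splits)
  then have "Min (total_degree ` Poly_Mapping.keys ?f) = total_degree e"
    using assms(1) by simp
  then show ?thesis
    unfolding initial_form_def using assms
    by (intro poly_mapping_eqI) (auto simp: lookup_homogeneous_summand lookup_minus lookup_single when_def)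
qed

lemma ring_of_type_algebra_simps [simp]:
  "carrier (ring_of_type_algebra :: 'a::ring_1 ring) = UNIV"
  "x \<oplus>\<^bsub>ring_of_type_algebra\<^esub> y = (x + y :: 'a)"
  "x \<otimes>\<^bsub>ring_of_type_algebra\<^esub> y = (x * y :: 'a)"
  "\<zero>\<^bsub>ring_of_type_algebra\<^esub> = (0 :: 'a)"
  "\<one>\<^bsub>ring_of_type_algebra\<^esub> = (1 :: 'a)"
  by (simp_all add: ring_of_type_algebra_def)

text \<open>Negatives need no separate condition: they arise by multiplication with
  \<open>-1\<close>.\<close>

lemma ideal_type_algebra_iff:
  fixes J :: "'a::comm_ring_1 set"
  shows "ideal J ring_of_type_algebra \<longleftrightarrow>
    0 \<in> J \<and> (\<forall>x\<in>J. \<forall>y\<in>J. x + y \<in> J) \<and> (\<forall>x. \<forall>y\<in>J. x * y \<in> J)"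
proof
  assume J: "ideal J (ring_of_type_algebra :: 'a ring)"
  interpret ideal J "ring_of_type_algebra :: 'a ring" by fact
  show "0 \<in> J \<and> (\<forall>x\<in>J. \<forall>y\<in>J. x + y \<in> J) \<and> (\<forall>x. \<forall>y\<in>J. x * y \<in> J)"
    using additive_subgroup.zero_closed[OF ideal.axioms(1)[OF J]]
      additive_subgroup.a_closed[OF ideal.axioms(1)[OF J]] ideal.I_l_closed[OF J] by simp
next
  assume J: "0 \<in> J \<and> (\<forall>x\<in>J. \<forall>y\<in>J. x + y \<in> J) \<and> (\<forall>x. \<forall>y\<in>J. x * y \<in> J)"
  interpret cring "ring_of_type_algebra :: 'a ring" by (rule cring_from_type_algebra)
  show "ideal J (ring_of_type_algebra :: 'a ring)"
  proof (rule idealI)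
    show "subgroup J (add_monoid (ring_of_type_algebra :: 'a ring))"
    proof (rule add.subgroupI)
      fix x assume "x \<in> J"
      have "\<ominus>\<^bsub>ring_of_type_algebra\<^esub> x = - x"
        by (rule minus_equality) auto
      moreover have "- x \<in> J" using J \<open>x \<in> J\<close> by (metis mult_minus1)
      ultimately show "\<ominus>\<^bsub>ring_of_type_algebra\<^esub> x \<in> J" by simp
    qed (use J in auto)
    show "x \<otimes>\<^bsub>ring_of_type_algebra\<^esub> y \<in> J" if "y \<in> J" for x y using J that by simp
    show "y \<otimes>\<^bsub>ring_of_type_algebra\<^esub> x \<in> J" if "y \<in> J" for x y
      using J that by (simp add: mult.commute[of y])
  qed (rule ring_axioms)
qed

text \<open>A monomial that is not \<open>maximal\<close> is the initial form of a binomial in the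
  toric ideal and so vanishes in the tangent cone. \<open>stable\<close> says that multiplication by
  the variable of index \<open>b\<close> kills no surviving monomial.\<close>

locale stable_weights =
  fixes m :: "4 \<Rightarrow> nat" and b :: 4 and maximal :: "(4 \<Rightarrow>\<^sub>0 nat) \<Rightarrow> bool"
  defines "maximal \<equiv> \<lambda>e. \<forall>e'. weight m e' = weight m e \<longrightarrow> total_degree e' \<le> total_degree e"
  assumes m_pos: "m b > 0" and m_min: "\<And>i. m b \<le> m i"
    and stable: "\<And>e. maximal e \<Longrightarrow> maximal (e + Poly_Mapping.single b 1)"
begin

text \<open>By \<open>weight_eq\<close>, any two of weight, total degree and excess determine the
  third. The excess gives a second grading, in which the variable of index \<open>b\<close> has
  degree \<open>0\<close>.\<close>

definition excess :: "(4 \<Rightarrow>\<^sub>0 nat) \<Rightarrow> nat" where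
  "excess e = weight (\<lambda>i. m i - m b) e"

lemma excess_add: "excess (d + e) = excess d + excess e"
  by (simp add: excess_def weight_add)

lemma weight_eq: "weight m e = m b * total_degree e + excess e"
  using m_min unfolding excess_def weight_def total_degree_def
  by (auto simp: sum_distrib_left sum.distrib[symmetric] distrib_right[symmetric] intro!: sum.cong)

lemma maximal_cong:
  assumes "excess d = excess e" "total_degree d = total_degree e"
  shows "maximal d \<longleftrightarrow> maximal e"
  using assms by (simp add: maximal_def weight_eq)

text \<open>A competitor of higher degree for \<open>e\<close> becomes, after adding
  \<open>d\<close>, a competitor for \<open>d + e\<close>.\<close>

lemma maximal_summand: "maximal (d + e) \<Longrightarrow> maximal e"
  unfolding maximal_def
  by (metis (no_types, lifting) add_le_cancel_left total_degree_add weight_add)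

lemma excess_zero_maximal:
  assumes "excess e = 0"
  shows "maximal e"
  unfolding maximal_def
proof (intro allI impI)
  fix e' assume "weight m e' = weight m e"
  then have "m b * total_degree e' \<le> m b * total_degree e" using assms weight_eq by (metis add_0_right le_add1)
  then show "total_degree e' \<le> total_degree e" using m_pos by simp
qed

text \<open>Other variables may tie with index \<open>b\<close> for the least weight. Since
  \<open>maximal\<close> depends only on excess and total degree, \<open>d\<close> can be replaced
  by a power of the variable of index \<open>b\<close>, and \<open>stable\<close> iterated.\<close>

lemma maximal_add_excess_zero:
  assumes "excess d = 0" "maximal e"
  shows "maximal (d + e)"
proof -
  have "maximal (e + Poly_Mapping.single b n)" for n
  proof (induction n)
    case (Suc n)
    have "e + Poly_Mapping.single b (Suc n) = e + Poly_Mapping.single b n + Poly_Mapping.single b 1"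
      by (simp add: add.assoc single_add[symmetric])
    then show ?case using stable[OF Suc] by simp
  qed (simp add: assms(2))
  moreover have "excess (Poly_Mapping.single b n) = 0" for n
    by (simp add: excess_def weight_single)
  ultimately show ?thesis
    using maximal_cong[of "d + e" "e + Poly_Mapping.single b (total_degree d)"] assms(1)
    by (simp add: excess_add total_degree_add total_degree_single)
qed

definition excess_bound :: nat where
  "excess_bound = (\<Sum>i\<in>UNIV. (m i - m b) * m b)"

text \<open>If \<open>m b < m i\<close>, the exponent of \<open>i\<close> in a maximal monomial is
  below \<open>m b\<close>; otherwise \<open>m b\<close> copies of variable \<open>i\<close> could
  be traded for \<open>m i\<close> copies of variable \<open>b\<close>, raising the degree.\<close>

lemma excess_le_bound:
  assumes "maximal e"
  shows "excess e \<le> excess_bound"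
  unfolding excess_def weight_def excess_bound_def
proof (intro sum_mono)
  fix i
  show "(m i - m b) * Poly_Mapping.lookup e i \<le> (m i - m b) * m b"
  proof (cases "m b < m i")
    case True
    have "Poly_Mapping.lookup e i < m b"
    proof (rule ccontr)
      assume *: "\<not> Poly_Mapping.lookup e i < m b"
      define d where "d = e - Poly_Mapping.single i (m b)"
      have e: "e = d + Poly_Mapping.single i (m b)"
        using * by (intro poly_mapping_eqI) (auto simp: d_def lookup_add lookup_minus lookup_single when_def)
      define e' where "e' = d + Poly_Mapping.single b (m i)"
      have "weight m e' = weight m e" by (simp add: e e'_def weight_add weight_single mult.commute)
      then have "total_degree e' \<le> total_degree e" using assms by (simp add: maximal_def)
      then show False using True by (simp add: e e'_def total_degree_add total_degree_single)
    qed
    then show ?thesis by simp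
  qed simp
qed

section \<open>Layers and the null ideal\<close>

definition layer :: "nat \<Rightarrow> 'k::field poly4 \<Rightarrow> 'k poly" where
  "layer j = lin_ext (\<lambda>e. if maximal e \<and> excess e = j then Polynomial.monom 1 (total_degree e) else 0)"

text \<open>Leaving out \<open>maximal\<close> makes multiplicativity immediate; by
  \<open>layer_0\<close> this is still the layer of excess \<open>0\<close>.\<close>

definition base :: "'k::field poly4 \<Rightarrow> 'k poly" where
  "base = lin_ext (\<lambda>e. if excess e = 0 then Polynomial.monom 1 (total_degree e) else 0)"

definition null_ideal :: "'k::field poly4 set" where
  "null_ideal = {f. \<forall>j. layer j f = 0}"

lemma layer_0: "layer 0 = base"
  unfolding layer_def base_def using excess_zero_maximal by (metis (no_types, lifting))

lemma layer_add: "layer j (f + g) = layer j f + layer j g"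
  and layer_diff: "layer j (f - g) = layer j f - layer j g"
  by (simp_all add: layer_def lin_ext_add lin_ext_diff)

lemma coeff_layer: "coeff (layer j f) k =
    (\<Sum>e\<in>Poly_Mapping.keys f. if (maximal e \<and> excess e = j) \<and> total_degree e = k then Poly_Mapping.lookup f e else 0)"
  unfolding layer_def by (rule coeff_lin_ext_monom)

lemma base_add: "base (f + g) = base f + base g"
  by (simp add: base_def lin_ext_add)

lemma base_mult: "base (f * g) = base f * base g"
  unfolding base_def by (rule lin_ext_mult) (simp add: excess_add total_degree_add mult_monom)

lemma base_one: "base 1 = 1"
proof -
  have "base (Poly_Mapping.single 0 1) = 1"
    unfolding base_def lin_ext_single by (simp add: excess_def weight_def total_degree_def)
  then show ?thesis by simp
qed

lemma base_surj: "\<exists>f. base f = p"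
proof
  show "base (\<Sum>k\<le>degree p. Poly_Mapping.single (Poly_Mapping.single b k) (coeff p k)) = p"
    by (simp add: base_def lin_ext_sum lin_ext_single excess_def weight_single total_degree_single
        smult_monom poly_as_sum_of_monoms)
qed

lemma layer_large: "j > excess_bound \<Longrightarrow> layer j f = 0"
  unfolding layer_def lin_ext_def using excess_le_bound by (intro sum.neutral) force

text \<open>For given excess and degree of \<open>d + e\<close>, maximality does not depend on
  \<open>e\<close>. Hence each coefficient of a layer of the product is an empty sum or a scalar
  times a coefficient of a layer of \<open>f\<close>.\<close>

lemma null_ideal_mult_single:
  assumes "f \<in> null_ideal"
  shows "Poly_Mapping.single d c * f \<in> null_ideal"
  unfolding null_ideal_def
proof (intro CollectI allI)
  fix j
  define g :: "(4 \<Rightarrow>\<^sub>0 nat) \<Rightarrow> 'a poly" where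
    "g = (\<lambda>e. if maximal (d + e) \<and> excess (d + e) = j then Polynomial.monom 1 (total_degree (d + e)) else 0)"
  have "layer j (Poly_Mapping.single d c * f) = lin_ext (\<lambda>_. 1) (Poly_Mapping.single d c) * lin_ext g f"
    unfolding layer_def by (rule lin_ext_mult) (simp add: g_def split: if_splits)
  moreover have "lin_ext g f = 0"
  proof (rule poly_eqI)
    fix k
    let ?A = "\<lambda>e. (maximal (d + e) \<and> excess (d + e) = j) \<and> total_degree (d + e) = k"
    have *: "coeff (lin_ext g f) k =
      (\<Sum>e\<in>Poly_Mapping.keys f. if ?A e then Poly_Mapping.lookup f e else 0)"
      unfolding g_def by (rule coeff_lin_ext_monom)
    show "coeff (lin_ext g f) k = coeff 0 k"
    proof (cases "\<exists>e0. ?A e0")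
      case True
      \<comment> \<open>\<open>e0\<close> also shows \<open>excess d \<le> j\<close> and
        \<open>total_degree d \<le> k\<close>, so the subtractions of naturals below are
        exact.\<close>
      then obtain e0 where e0: "?A e0" by blast
      have "?A e \<longleftrightarrow> (maximal e \<and> excess e = j - excess d) \<and> total_degree e = k - total_degree d" for e
      proof
        assume "?A e"
        then show "(maximal e \<and> excess e = j - excess d) \<and> total_degree e = k - total_degree d"
          using maximal_summand[of d e] by (auto simp: excess_add total_degree_add)
      next
        assume "(maximal e \<and> excess e = j - excess d) \<and> total_degree e = k - total_degree d"
        then have "excess (d + e) = j" "total_degree (d + e) = k"
          using e0 by (auto simp: excess_add total_degree_add)
        then show "?A e" using maximal_cong[of "d + e" "d + e0"] e0 by simp
      qed
      then have "coeff (lin_ext g f) k = coeff (layer (j - excess d) f) (k - total_degree d)"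
        unfolding * coeff_layer by simp
      then show ?thesis using assms by (simp add: null_ideal_def)
    next
      case False
      then have "coeff (lin_ext g f) k = 0" unfolding * by (intro sum.neutral) auto
      then show ?thesis by simp
    qed
  qed
  ultimately show "layer j (Poly_Mapping.single d c * f) = 0" by simp
qed

lemma null_ideal_add: "f \<in> null_ideal \<Longrightarrow> g \<in> null_ideal \<Longrightarrow> f + g \<in> null_ideal"
  and null_ideal_zero: "0 \<in> null_ideal"
  by (simp_all add: null_ideal_def layer_add) (simp add: layer_def)

lemma null_ideal_mult:
  assumes "g \<in> null_ideal"
  shows "f * g \<in> null_ideal"
proof (induction f rule: poly_mapping_add_induct)
  case zero
  then show ?case by (simp add: null_ideal_zero)
next
  case (add f e c)
  then show ?case
    by (simp add: distrib_right null_ideal_add null_ideal_mult_single[OF assms])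
qed

lemma null_ideal_ideal: "ideal null_ideal poly4_ring"
  by (simp add: ideal_type_algebra_iff null_ideal_zero null_ideal_add null_ideal_mult)

text \<open>All terms of \<open>f\<close> have degree at least \<open>d\<close>. Those with the
  weight of a maximal monomial of degree \<open>d\<close> have degree exactly \<open>d\<close>, so
  the layer coefficient is a full coefficient of \<open>toric_hom m f\<close>, which
  vanishes.\<close>

lemma initial_form_null:
  assumes "f \<in> toric_ideal m" "f \<noteq> 0"
  shows "initial_form f \<in> null_ideal"
  unfolding null_ideal_def
proof (intro CollectI allI poly_eqI)
  fix j k
  define d where "d = Min (total_degree ` Poly_Mapping.keys f)"
  let ?A = "\<lambda>e. (maximal e \<and> excess e = j) \<and> total_degree e = k"
  have lookup: "Poly_Mapping.lookup (initial_form f) e = (if total_degree e = d then Poly_Mapping.lookup f e else 0)" for e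
    by (simp add: initial_form_def d_def lookup_homogeneous_summand)
  have "coeff (layer j (initial_form f)) k =
    (\<Sum>e\<in>Poly_Mapping.keys (initial_form f). if ?A e then Poly_Mapping.lookup (initial_form f) e else 0)"
    by (rule coeff_layer)
  also have "\<dots> = (\<Sum>e\<in>Poly_Mapping.keys f. if ?A e then Poly_Mapping.lookup (initial_form f) e else 0)"
    by (rule sum.mono_neutral_left) (auto simp: in_keys_iff lookup split: if_splits)
  also have "\<dots> = 0"
  proof (cases "k = d \<and> (\<exists>e0. ?A e0)")
    case True
    then obtain e0 where e0: "?A e0" and k: "k = d" by blast
    have "?A e \<longleftrightarrow> weight m e = weight m e0" if e: "e \<in> Poly_Mapping.keys f" for e
    proof
      assume "?A e"
      then show "weight m e = weight m e0" using e0 by (simp add: weight_eq)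
    next
      assume wt: "weight m e = weight m e0"
      have "d \<le> total_degree e" using e by (simp add: d_def)
      moreover have "total_degree e \<le> d" using e0 wt k by (auto simp: maximal_def)
      ultimately have "total_degree e = total_degree e0" using e0 k by simp
      moreover have "excess e = excess e0" using wt calculation by (simp add: weight_eq)
      ultimately show "?A e" using maximal_cong[of e e0] e0 by simp
    qed
    then have "(\<Sum>e\<in>Poly_Mapping.keys f. if ?A e then Poly_Mapping.lookup (initial_form f) e else 0) =
      (\<Sum>e\<in>Poly_Mapping.keys f. if True \<and> weight m e = weight m e0 then Poly_Mapping.lookup f e else 0)"
      using k by (intro sum.cong) (auto simp: lookup)
    also have "\<dots> = coeff (toric_hom m f) (weight m e0)"
      using coeff_lin_ext_monom[of "\<lambda>_. True" "weight m" f "weight m e0"]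
      by (simp add: toric_hom_eq_lin_ext)
    finally show ?thesis using assms by (simp add: toric_ideal_def)
  next
    case False
    then show ?thesis by (intro sum.neutral) (auto simp: lookup)
  qed
  finally show "coeff (layer j (initial_form f)) k = coeff 0 k" by simp
qed

text \<open>Equal excess and degree give a homogeneous binomial in the toric ideal, which is its own
  initial form; a monomial that is not maximal is itself an initial form.\<close>

lemma monomial_normal_form:
  fixes J :: "'k::field poly4 set"
  assumes J: "J = initial_ideal (toric_ideal m)"
    and x: "excess x = excess e" "total_degree x = total_degree e"
  shows "Poly_Mapping.single e 1 - (if maximal e then Poly_Mapping.single x 1 else 0) \<in> J"
proof -
  interpret cring "poly4_ring :: 'k poly4 ring" by (rule cring_from_type_algebra)
  have ideal: "ideal J poly4_ring" unfolding J initial_ideal_def by (rule genideal_ideal) simp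
  have init: "initial_form f \<in> J" if "f \<in> toric_ideal m" "f \<noteq> 0" for f
  proof -
    have "{initial_form f | f. f \<in> (toric_ideal m :: 'k poly4 set) \<and> f \<noteq> 0} \<subseteq> J"
      unfolding J initial_ideal_def by (rule genideal_self) simp
    then show ?thesis using that by blast
  qed
  have toric: "Poly_Mapping.single e 1 - Poly_Mapping.single e' 1 \<in> toric_ideal m"
    if "weight m e = weight m e'" for e'
    using that by (simp add: toric_ideal_def toric_hom_eq_lin_ext lin_ext_diff lin_ext_single)
  have nz: "Poly_Mapping.single e 1 - Poly_Mapping.single e' (1::'k) \<noteq> 0" if "e \<noteq> e'" for e'
  proof -
    have "Poly_Mapping.lookup (Poly_Mapping.single e 1 - Poly_Mapping.single e' (1::'k)) e = 1"
      using that by (simp add: lookup_minus lookup_single when_def)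
    then show ?thesis by (metis lookup_zero zero_neq_one)
  qed
  show ?thesis
  proof (cases "maximal e")
    case True
    show ?thesis
    proof (cases "x = e")
      case True
      then show ?thesis using ideal \<open>maximal e\<close> by (simp add: ideal_type_algebra_iff)
    next
      case False
      have "weight m e = weight m x" using x by (simp add: weight_eq)
      then show ?thesis
        using init[OF toric nz, of x] initial_form_single_diff[of e x, where 'k = 'k] x False True
        by simp
    qed
  next
    case False
    then obtain e' where e': "weight m e' = weight m e" "total_degree e < total_degree e'"
      by (auto simp: maximal_def not_le)
    then have "e \<noteq> e'" by auto
    then show ?thesis
      using init[OF toric nz, of e'] initial_form_single_diff[of e e', where 'k = 'k] e' False by simp
  qed
qed

text \<open>For the harder inclusion, every monomial is reduced modulo the initial ideal to
  \<open>nf\<close>. The layers are the coefficients of the resulting normal form, so elements of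
  the null ideal reduce to \<open>0\<close>.\<close>

lemma initial_ideal_eq: "initial_ideal (toric_ideal m) = (null_ideal :: 'k::field poly4 set)"
proof
  interpret cring "poly4_ring :: 'k poly4 ring" by (rule cring_from_type_algebra)
  show "initial_ideal (toric_ideal m) \<subseteq> (null_ideal :: 'k poly4 set)"
    unfolding initial_ideal_def by (rule genideal_minimal[OF null_ideal_ideal]) (use initial_form_null in auto)
  define J :: "'k poly4 set" where "J = initial_ideal (toric_ideal m)"
  have ideal: "ideal J poly4_ring" unfolding J_def initial_ideal_def by (rule genideal_ideal) simp
  \<comment> \<open>One monomial is chosen for each pair of excess and total degree that
    occurs.\<close>
  define rep where "rep = (\<lambda>e. SOME e'. excess e' = excess e \<and> total_degree e' = total_degree e)"
  have rep: "excess (rep e) = excess e \<and> total_degree (rep e) = total_degree e" for e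
    unfolding rep_def by (rule someI[of _ e]) simp
  have rep_iff: "rep e = rep e' \<longleftrightarrow> excess e = excess e' \<and> total_degree e = total_degree e'" for e e'
    using rep[of e] rep[of e'] by (auto simp: rep_def)
  define nf :: "(4 \<Rightarrow>\<^sub>0 nat) \<Rightarrow> 'k poly4" where
    "nf = (\<lambda>e. if maximal e then Poly_Mapping.single (rep e) 1 else 0)"
  show "(null_ideal :: 'k poly4 set) \<subseteq> initial_ideal (toric_ideal m)"
    unfolding J_def[symmetric]
  proof
    fix f :: "'k poly4" assume f: "f \<in> null_ideal"
    have "(\<Sum>e\<in>Poly_Mapping.keys f. Poly_Mapping.single 0 (Poly_Mapping.lookup f e) * nf e) = 0"
    proof (rule poly_mapping_eqI)
      fix x
      have sum: "Poly_Mapping.lookup (\<Sum>e\<in>Poly_Mapping.keys f. Poly_Mapping.single 0 (Poly_Mapping.lookup f e) * nf e) x =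
        (\<Sum>e\<in>Poly_Mapping.keys f. if maximal e \<and> rep e = x then Poly_Mapping.lookup f e else 0)"
        unfolding lookup_sum nf_def
        by (intro sum.cong) (auto simp: mult_single lookup_single when_def)
      show "Poly_Mapping.lookup (\<Sum>e\<in>Poly_Mapping.keys f. Poly_Mapping.single 0 (Poly_Mapping.lookup f e) * nf e) x =
        Poly_Mapping.lookup 0 x"
      proof (cases "\<exists>e0. rep e0 = x")
        case True
        then obtain e0 where "rep e0 = x" by blast
        then have "maximal e \<and> rep e = x \<longleftrightarrow> (maximal e \<and> excess e = excess e0) \<and> total_degree e = total_degree e0" for e
          using rep_iff[of e e0] by auto
        then have "(\<Sum>e\<in>Poly_Mapping.keys f. if maximal e \<and> rep e = x then Poly_Mapping.lookup f e else 0) =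
          Polynomial.coeff (layer (excess e0) f) (total_degree e0)"
          unfolding coeff_layer by simp
        then show ?thesis using f sum by (simp add: null_ideal_def)
      next
        case False
        then have "(\<Sum>e\<in>Poly_Mapping.keys f. if maximal e \<and> rep e = x then Poly_Mapping.lookup f e else 0) = 0"
          by (intro sum.neutral) auto
        then show ?thesis unfolding sum by simp
      qed
    qed
    then have "f = (\<Sum>e\<in>Poly_Mapping.keys f. Poly_Mapping.single e (Poly_Mapping.lookup f e)) -
        (\<Sum>e\<in>Poly_Mapping.keys f. Poly_Mapping.single 0 (Poly_Mapping.lookup f e) * nf e)"
      using poly_mapping_expansion[of f] by simp
    also have "\<dots> = (\<Sum>e\<in>Poly_Mapping.keys f. Poly_Mapping.single 0 (Poly_Mapping.lookup f e) *
        (Poly_Mapping.single e 1 - nf e))"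
      by (simp add: sum_subtractf right_diff_distrib mult_single)
    also have "\<dots> \<in> J"
    proof -
      have mem: "Poly_Mapping.single 0 (Poly_Mapping.lookup f e) * (Poly_Mapping.single e 1 - nf e) \<in> J" for e
        using monomial_normal_form[OF J_def, of "rep e" e] rep[of e] ideal
        unfolding nf_def ideal_type_algebra_iff by blast
      have "(\<Sum>e\<in>A. Poly_Mapping.single 0 (Poly_Mapping.lookup f e) * (Poly_Mapping.single e 1 - nf e)) \<in> J" for A
        by (induction A rule: infinite_finite_induct) (use ideal mem in \<open>auto simp: ideal_type_algebra_iff\<close>)
      then show ?thesis .
    qed
    finally show "f \<in> J" .
  qed
qed

text \<open>Modulo the null ideal, \<open>z\<close> may be replaced by its part \<open>z'\<close> of excess at least \<open>j\<close>; in \<open>y * z'\<close> only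
  the excess-zero part of \<open>y\<close> then contributes to layer \<open>j\<close>.\<close>
lemma layer_mult:
  assumes low: "\<And>i. i < j \<Longrightarrow> layer i z = 0"
  shows "layer j (y * z) = base y * layer j z" and "\<And>i. i < j \<Longrightarrow> layer i (y * z) = 0"
proof -
  define z' where "z' = (\<Sum>e\<in>{e\<in>Poly_Mapping.keys z. j \<le> excess e}. Poly_Mapping.single e (Poly_Mapping.lookup z e))"
  have lookup: "Poly_Mapping.lookup z' e = (if j \<le> excess e then Poly_Mapping.lookup z e else 0)" for e
  proof -
    have "Poly_Mapping.lookup z' e =
      (\<Sum>e'\<in>{e\<in>Poly_Mapping.keys z. j \<le> excess e}. if e' = e then Poly_Mapping.lookup z e else 0)"
      unfolding z'_def lookup_sum by (intro sum.cong) (auto simp: lookup_single when_def)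
    then show ?thesis by (auto simp: in_keys_iff)
  qed
  have keys: "j \<le> excess e" if "e \<in> Poly_Mapping.keys z'" for e
    using that by (auto simp: in_keys_iff lookup split: if_splits)
  have sub: "Poly_Mapping.keys z' \<subseteq> Poly_Mapping.keys z"
    by (auto simp: in_keys_iff lookup split: if_splits)
  have layer_z': "layer i z' = layer i z" if "j \<le> i" for i
    unfolding layer_def lin_ext_superset[OF finite_keys sub] lin_ext_def[of _ z]
    using that by (intro sum.cong) (auto simp: lookup)
  moreover have "layer i z' = 0" if "i < j" for i
    unfolding layer_def lin_ext_def using that keys by (intro sum.neutral) force
  ultimately have "z - z' \<in> null_ideal"
    using low by (auto simp: null_ideal_def layer_diff) (metis not_le right_minus_eq)
  then have "y * (z - z') \<in> null_ideal" by (rule null_ideal_mult)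
  then have eq: "layer i (y * z) = layer i (y * z')" for i
    by (simp add: null_ideal_def layer_diff right_diff_distrib)
  have "layer j (y * z') = base y * layer j z'"
    unfolding layer_def base_def
  proof (rule lin_ext_mult)
    fix d e :: "4 \<Rightarrow>\<^sub>0 nat" assume "e \<in> Poly_Mapping.keys z'"
    then have e: "j \<le> excess e" by (rule keys)
    \<comment> \<open>This is where stability enters: a factor of excess \<open>0\<close> preserves
      maximality.\<close>
    have "maximal (d + e) \<and> excess (d + e) = j \<longleftrightarrow> excess d = 0 \<and> maximal e \<and> excess e = j"
      using e maximal_summand[of d e] maximal_add_excess_zero[of d e] by (auto simp: excess_add)
    then show "(if maximal (d + e) \<and> excess (d + e) = j then Polynomial.monom 1 (total_degree (d + e)) else 0) =
        (if excess d = 0 then Polynomial.monom 1 (total_degree d) else 0) *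
        (if maximal e \<and> excess e = j then Polynomial.monom 1 (total_degree e) else (0 :: 'a poly))"
      by (auto simp: total_degree_add mult_monom)
  qed
  then show "layer j (y * z) = base y * layer j z" using eq layer_z' by simp
  show "layer i (y * z) = 0" if "i < j" for i
  proof -
    have "layer i (y * z') = lin_ext (\<lambda>_. 0) y * lin_ext (\<lambda>_. 0) z'"
      unfolding layer_def
      by (rule lin_ext_mult) (use keys that in \<open>force simp: excess_add\<close>)
    then show ?thesis using eq by (simp add: lin_ext_def)
  qed
qed

section \<open>Regularity, nilpotence and finite generation modulo the null ideal\<close>

lemma null_ideal_base: "f \<in> null_ideal \<Longrightarrow> base f = 0"
  by (simp add: null_ideal_def layer_0[symmetric])

text \<open>Once the lower layers of \<open>z\<close> vanish, layer \<open>j\<close> of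
  \<open>y * z\<close> is \<open>base y * layer j z\<close>, and \<open>K[t]\<close> is a
  domain.\<close>

lemma null_ideal_regular:
  assumes "base y \<noteq> 0" "y * z \<in> null_ideal"
  shows "z \<in> null_ideal"
proof -
  have "layer j z = 0" for j
  proof (induction j rule: less_induct)
    case (less j)
    then have "base y * layer j z = 0" using layer_mult(1)[of j z y] assms(2) by (simp add: null_ideal_def)
    then show ?case using assms(1) by simp
  qed
  then show ?thesis by (simp add: null_ideal_def)
qed

text \<open>As \<open>base z = 0\<close>, each further factor \<open>z\<close> annihilates one more
  layer, and layers beyond \<open>excess_bound\<close> vanish anyway.\<close>

lemma null_ideal_nilpotent:
  assumes "base z = 0"
  shows "\<exists>n. z ^ n \<in> null_ideal"
proof -
  have "\<forall>i<n. layer i (z ^ n) = 0" for n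
  proof (induction n)
    case (Suc n)
    then have low: "\<And>i. i < n \<Longrightarrow> layer i (z ^ n) = 0" by blast
    show ?case
    proof (intro allI impI)
      fix i assume "i < Suc n"
      then show "layer i (z ^ Suc n) = 0"
        using layer_mult(1)[OF low, where y = z] layer_mult(2)[OF low, where y = z and i = i] assms
        by (cases "i = n") simp_all
    qed
  qed simp
  then have "layer i (z ^ Suc excess_bound) = 0" for i
    using layer_large[of i] by (metis less_Suc_eq_le not_le)
  then show ?thesis unfolding null_ideal_def by blast
qed

text \<open>Filtering an ideal \<open>J\<close> by the order of vanishing along the layers, the leading layers of each
  step form an ideal of \<open>K[t]\<close>, which is principal; lifts of the generators generate \<open>J\<close> modulo the
  null ideal, since only finitely many layers are nonzero.\<close>
lemma finitely_generated_mod_null_ideal: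
  fixes J :: "'k::field poly4 set"
  assumes J: "ideal J poly4_ring"
  obtains A where "finite A" "A \<subseteq> J"
    "\<And>H. ideal H poly4_ring \<Longrightarrow> null_ideal \<subseteq> H \<Longrightarrow> A \<subseteq> H \<Longrightarrow> J \<subseteq> H"
proof -
  define F where "F j = {z \<in> J. \<forall>i<j. layer i z = 0}" for j
  have F_add: "y + z \<in> F j" if "y \<in> F j" "z \<in> F j" for y z j
    using that J by (simp add: F_def ideal_type_algebra_iff layer_add)
  have F_mult: "y * z \<in> F j" if "z \<in> F j" for y z j
    using that J layer_mult(2)[of j z _ y] by (simp add: F_def ideal_type_algebra_iff)
  have F_layer: "layer j (y * z) = base y * layer j z" if "z \<in> F j" for y z j
    using that layer_mult(1)[of j z y] by (simp add: F_def)
  have "\<exists>z\<in>F j. \<forall>y\<in>F j. layer j z dvd layer j y" for j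
  proof -
    have "\<exists>p. \<forall>q. q \<in> layer j ` F j \<longleftrightarrow> p dvd q"
    proof (rule poly_ideal_principal)
      have "0 \<in> F j" using J by (simp add: F_def ideal_type_algebra_iff layer_def)
      moreover have "layer j (0 :: 'k poly4) = 0" by (simp add: layer_def)
      ultimately show "0 \<in> layer j ` F j" by (metis image_eqI)
      show "p + q \<in> layer j ` F j" if pq: "p \<in> layer j ` F j" "q \<in> layer j ` F j" for p q
      proof -
        obtain y z where "y \<in> F j" "z \<in> F j" "p = layer j y" "q = layer j z" using pq by blast
        then show ?thesis using F_add layer_add by (metis image_eqI)
      qed
      show "p * q \<in> layer j ` F j" if q: "q \<in> layer j ` F j" for p q
      proof -
        obtain y z where "base y = p" "z \<in> F j" "q = layer j z" using q base_surj by blast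
        then show ?thesis using F_mult F_layer by (metis image_eqI)
      qed
    qed
    then obtain p where p: "\<And>q. q \<in> layer j ` F j \<longleftrightarrow> p dvd q" by blast
    then have "p \<in> layer j ` F j" by simp
    then obtain z where "z \<in> F j" "p = layer j z" by blast
    then show ?thesis using p by blast
  qed
  then obtain g where g: "\<And>j. g j \<in> F j" "\<And>j y. y \<in> F j \<Longrightarrow> layer j (g j) dvd layer j y"
    by metis
  show ?thesis
  proof (rule that)
    show "finite (g ` {..excess_bound})" by simp
    show "g ` {..excess_bound} \<subseteq> J" using g(1) by (auto simp: F_def)
    fix H :: "'k poly4 set"
    assume H: "ideal H poly4_ring" "null_ideal \<subseteq> H" "g ` {..excess_bound} \<subseteq> H"
    \<comment> \<open>\<open>n\<close> bounds the number of remaining layers; when \<open>j\<close>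
      exceeds \<open>excess_bound\<close>, all layers of \<open>z\<close> vanish.\<close>
    have "z \<in> H" if "z \<in> F j" "excess_bound < n + j" for z j n
      using that
    proof (induction n arbitrary: z j)
      case 0
      have "layer i z = 0" for i
        using layer_large[of i z] 0 by (cases "i < j") (auto simp: F_def)
      then show ?case using H(2) by (auto simp: null_ideal_def)
    next
      case (Suc n)
      show ?case
      proof (cases "j \<le> excess_bound")
        case True
        \<comment> \<open>Adding \<open>y * g j\<close> with \<open>base y = - c\<close> cancels
          layer \<open>j\<close> and moves \<open>z\<close> one step down the filtration.\<close>
        obtain c where "layer j z = layer j (g j) * c" using g(2)[OF Suc.prems(1)] by (rule dvdE)
        moreover obtain y where "base y = - c" using base_surj by blast
        ultimately have "layer j (y * g j) = - layer j z" by (simp add: F_layer[OF g(1)] mult.commute)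
        then have "layer j (z + y * g j) = 0" by (simp add: layer_add)
        moreover have "z + y * g j \<in> F j" using F_add F_mult g(1) Suc.prems(1) by blast
        ultimately have "z + y * g j \<in> F (Suc j)" by (auto simp: F_def less_Suc_eq)
        then have "z + y * g j \<in> H" using Suc.IH[of "z + y * g j" "Suc j"] Suc.prems(2) by simp
        moreover have "- y * g j \<in> H" using H True unfolding ideal_type_algebra_iff by blast
        ultimately have "(z + y * g j) + - y * g j \<in> H" using H(1) unfolding ideal_type_algebra_iff by blast
        then show ?thesis by simp
      next
        case False
        have "layer i z = 0" for i
          using layer_large[of i z] False Suc.prems(1) by (cases "i < j") (auto simp: F_def)
        then show ?thesis using H(2) by (auto simp: null_ideal_def)
      qed
    qed
    moreover have "J = F 0" by (simp add: F_def)
    ultimately show "J \<subseteq> H" by (metis less_add_same_cancel1 less_Suc_eq_0_disj subsetI zero_less_Suc add.right_neutral lessI)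
  qed
qed

end

section \<open>Maximal degrees for two glued blocks\<close>

text \<open>A relation that does not come from the two blocks separately trades \<open>g * Q\<close> units of the first
  block for \<open>g * P\<close> units of the second; as \<open>Q\<close> is large, this lowers the total degree.\<close>
lemma degree_exchange:
  fixes a1 a2 a3 a4 P Q p1 p2 p3 p4 q1 q2 q3 q4 :: nat
  assumes cop: "coprime a1 a2" "coprime P Q" and le: "a1 \<le> a2" "a4 \<le> a3"
    and pos: "a1 > 0" "a2 > 0" "a3 > 0" "a4 > 0" "P > 0"
    and large: "a2 * (a1 + a3 + P) \<le> Q"
    and wt: "(a2 * p1 + a1 * p2) * P + (a4 * p3 + a3 * p4) * Q =
      (a2 * q1 + a1 * (q2 + 1)) * P + (a4 * q3 + a3 * q4) * Q"
    and deg: "q1 + q2 + q3 + q4 + 1 < p1 + p2 + p3 + p4"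
  shows "\<exists>r1 r2 r3 r4. (a2 * r1 + a1 * r2) * P + (a4 * r3 + a3 * r4) * Q =
      (a2 * q1 + a1 * q2) * P + (a4 * q3 + a3 * q4) * Q \<and> q1 + q2 + q3 + q4 < r1 + r2 + r3 + r4"
proof (rule ccontr)
  assume *: "\<not> ?thesis"
  \<comment> \<open>\<open>p\<close> competes with \<open>q\<close> times the second variable. If
    \<open>p\<close> contained that variable, cancelling it would give the required
    \<open>r\<close>.\<close>
  have p2: "p2 = 0"
  proof (rule ccontr)
    assume "p2 \<noteq> 0"
    then obtain r2 where "p2 = Suc r2" by (cases p2) auto
    then have "(a2 * p1 + a1 * r2) * P + (a4 * p3 + a3 * p4) * Q =
      (a2 * q1 + a1 * q2) * P + (a4 * q3 + a3 * q4) * Q \<and> q1 + q2 + q3 + q4 < p1 + r2 + p3 + p4"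
      using wt deg by (simp add: algebra_simps)
    then show False using * by blast
  qed
  \<comment> \<open>Otherwise \<open>a1\<close> copies of the first variable can be traded for
    \<open>a2\<close> copies of the second without losing degree, and one of these is
    cancelled.\<close>
  have p1: "p1 < a1"
  proof (rule ccontr)
    assume "\<not> p1 < a1"
    then obtain r1 where r1: "p1 = r1 + a1" by (metis add.commute le_Suc_ex not_less)
    obtain a2' where a2': "a2 = Suc a2'" using pos by (cases a2) auto
    have "(a2 * r1 + a1 * a2') * P + (a4 * p3 + a3 * p4) * Q =
      (a2 * q1 + a1 * q2) * P + (a4 * q3 + a3 * q4) * Q"
      using wt unfolding p2 r1 a2' by (simp add: algebra_simps)
    moreover have "q1 + q2 + q3 + q4 < r1 + a2' + p3 + p4" using deg le a2' r1 p2 by simp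
    ultimately show False using * by blast
  qed
  \<comment> \<open>Trading \<open>a4\<close> copies of the fourth variable in \<open>q\<close> for
    \<open>a3 > a4\<close> copies of the third would already give \<open>r\<close>.\<close>
  have q4: "a3 = a4 \<or> q4 < a4"
  proof (rule ccontr)
    assume "\<not> (a3 = a4 \<or> q4 < a4)"
    then obtain r4 where r4: "q4 = r4 + a4" and "a4 < a3" using le by (metis add.commute le_Suc_ex not_less order_le_less)
    then have "(a2 * q1 + a1 * q2) * P + (a4 * (q3 + a3) + a3 * r4) * Q =
      (a2 * q1 + a1 * q2) * P + (a4 * q3 + a3 * q4) * Q" by (simp add: algebra_simps)
    moreover have "q1 + q2 + q3 + q4 < q1 + q2 + (q3 + a3) + r4" using r4 \<open>a4 < a3\<close> by simp
    ultimately show False using * by blast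
  qed
  have "a2 * P > 0" using pos by simp
  then have Q: "Q > 0" "a1 * a2 \<le> Q" using large by (auto simp: algebra_simps intro: gr0I)
  define xq yq xp yp where "xq = a2 * q1 + a1 * (q2 + 1)" and "yq = a4 * q3 + a3 * q4"
    and "xp = a2 * p1" and "yp = a4 * p3 + a3 * p4"
  have eq: "xp * P + yp * Q = xq * P + yq * Q"
    using wt p2 by (simp add: xq_def yq_def xp_def yp_def)
  then have eq': "(int xq - int xp) * int P = (int yp - int yq) * int Q"
    using arg_cong[OF eq, of int] unfolding of_nat_add of_nat_mult by (simp add: algebra_simps)
  \<comment> \<open>Coprimality of \<open>P\<close> and \<open>Q\<close> makes the two blocks differ
    by \<open>Q * c\<close> and \<open>P * c\<close> for a common \<open>c\<close>.\<close>
  then have "int Q dvd (int xq - int xp) * int P" by simp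
  moreover have "coprime (int Q) (int P)" using cop(2) by (simp add: coprime_commute)
  ultimately have "int Q dvd int xq - int xp" by (metis coprime_dvd_mult_left_iff)
  then obtain c where c: "int xq - int xp = int Q * c" by (rule dvdE)
  then have c': "int yp - int yq = int P * c" using eq' Q(1) by (simp add: mult_ac)
  have "xp < Q"
  proof -
    have "xp < a2 * a1" unfolding xp_def using p1 pos by simp
    then show ?thesis using Q(2) by (simp add: mult.commute)
  qed
  \<comment> \<open>For \<open>c = 0\<close> the first blocks balance alone and \<open>a1\<close>
    divides the positive number \<open>p1 - q1\<close>, against \<open>p1 < a1\<close>. For
    \<open>c < 0\<close> the first block of \<open>p\<close> would reach \<open>Q\<close>.\<close>
  have "c > 0"
  proof (rule ccontr)
    assume "\<not> c > 0"
    show False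
    proof (cases "c = 0")
      case True
      then have "xq = xp" using c by simp
      then have e: "a2 * q1 + a1 * (q2 + 1) = a2 * p1" by (simp add: xq_def xp_def)
      then have "q1 < p1" using pos by (metis add_lessD1 less_add_same_cancel1 mult_less_cancel1 mult_pos_pos zero_less_one add_gr_0)
      then obtain d where d: "p1 = q1 + d" "d > 0" by (metis less_imp_add_positive)
      then have "a1 * (q2 + 1) = a2 * d" using e by (simp add: algebra_simps)
      then have "a1 dvd a2 * d" by (metis dvd_triv_left)
      then have "a1 dvd d" using cop(1) by (simp add: coprime_dvd_mult_right_iff)
      then show False using d p1 by (auto dest: dvd_imp_le)
    next
      case False
      then have "c \<le> -1" using \<open>\<not> c > 0\<close> by simp
      then have "int Q * c \<le> int Q * (-1)" by (intro mult_left_mono) auto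
      then show False using c \<open>xp < Q\<close> by simp
    qed
  qed
  then obtain g where g: "c = int g" "g \<ge> 1" by (metis int_one_le_iff_zero_less nonneg_int_cases of_nat_1 of_nat_le_iff order_less_imp_le)
  have xq: "xq = xp + g * Q" and yq: "yp = yq + g * P"
    using c c' g(1) by (metis add.commute diff_eq_eq mult.commute of_nat_add of_nat_eq_iff of_nat_mult)+
  \<comment> \<open>The first block of \<open>q\<close> must supply \<open>g * Q\<close>, which
    forces a large \<open>q1 + q2\<close>. The second block of \<open>p\<close> gains at most
    \<open>a3 + g * P\<close> in degree over that of \<open>q\<close>, too little to
    compensate.\<close>
  have "a2 * (g * (a1 + a3 + P)) \<le> g * Q" using large by (metis mult.left_commute mult_le_mono2)
  also have "\<dots> \<le> xq" using xq by simp
  also have "\<dots> \<le> a2 * (q1 + q2 + 1)" using mult_le_mono1[OF le(1), of "q2 + 1"] by (simp add: xq_def algebra_simps)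
  finally have "g * (a1 + a3 + P) \<le> q1 + q2 + 1" using pos(2) by (metis mult_le_cancel1)
  moreover have "a1 + a3 + g * P \<le> g * (a1 + a3 + P)" using g(2) by (simp add: algebra_simps add_mono)
  ultimately have 1: "a1 + a3 + g * P \<le> q1 + q2 + 1" by simp
  have "a4 * (p3 + p4) \<le> yp" using mult_le_mono1[OF le(2), of p4] by (simp add: yp_def algebra_simps)
  also have "\<dots> = yq + g * P" by (rule yq)
  also have "yq \<le> a4 * (q3 + q4 + a3)"
  proof (cases "a3 = a4")
    case False
    then have "a3 * q4 \<le> a3 * a4" using q4 by simp
    also have "\<dots> \<le> a4 * (q4 + a3)" by (simp add: algebra_simps)
    finally show ?thesis by (simp add: yq_def distrib_left)
  qed (simp add: yq_def algebra_simps)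
  also have "g * P \<le> a4 * (g * P)" using pos by simp
  finally have "a4 * (p3 + p4) \<le> a4 * (q3 + q4 + a3 + g * P)" by (simp add: algebra_simps)
  then have "p3 + p4 \<le> q3 + q4 + a3 + g * P" using pos by simp
  then show False using 1 p1 p2 deg by linarith
qed

lemma UNIV_4_distinct:
  assumes "distinct [i1, i2, i3, i4 :: 4]"
  shows "UNIV = {i1, i2, i3, i4}"
proof -
  have "card {i1, i2, i3, i4} = card (UNIV :: 4 set)" using assms by simp
  then show ?thesis by (metis card_subset_eq finite subset_UNIV)
qed

text \<open>\<open>i2\<close> carries the least entry: by \<open>a1 \<le> a2\<close> within its
  block, by the size of \<open>Q\<close> against the other. A failure of stability is turned by
  \<open>degree_exchange\<close> into a failure of maximality of \<open>e\<close>. Keeping the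
  indices variable covers every ordering inside the blocks.\<close>

lemma stable_weights_two_blocks:
  fixes m :: "4 \<Rightarrow> nat" and i1 i2 i3 i4 :: 4
  assumes dist: "distinct [i1, i2, i3, i4]"
    and m: "m i1 = a2 * P" "m i2 = a1 * P" "m i3 = a4 * Q" "m i4 = a3 * Q"
    and cop: "coprime a1 a2" "coprime P Q" and le: "a1 \<le> a2" "a4 \<le> a3"
    and pos: "a1 > 0" "a2 > 0" "a3 > 0" "a4 > 0" "P > 0"
    and large: "a2 * (a1 + a3 + P) \<le> Q"
  shows "stable_weights m i2"
proof
  have UNIV: "UNIV = {i1, i2, i3, i4}" using dist by (rule UNIV_4_distinct)
  have weight: "weight m e = (a2 * Poly_Mapping.lookup e i1 + a1 * Poly_Mapping.lookup e i2) * P +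
      (a4 * Poly_Mapping.lookup e i3 + a3 * Poly_Mapping.lookup e i4) * Q" for e
    unfolding weight_def UNIV using dist by (simp add: m algebra_simps)
  have degree: "total_degree e = Poly_Mapping.lookup e i1 + Poly_Mapping.lookup e i2 +
      Poly_Mapping.lookup e i3 + Poly_Mapping.lookup e i4" for e
    unfolding total_degree_def UNIV using dist by simp
  show "0 < m i2" using m pos by simp
  have "a1 * P \<le> a2 * P" using le by simp
  also have "\<dots> \<le> Q" using large by (simp add: distrib_left)
  finally have *: "a1 * P \<le> Q" .
  have "a1 * P \<le> a4 * Q" "a1 * P \<le> a3 * Q"
    using mult_le_mono[of 1 a4, OF _ *] mult_le_mono[of 1 a3, OF _ *] pos by simp_all
  then have "\<forall>i\<in>{i1, i2, i3, i4}. m i2 \<le> m i" using m le by auto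
  then show "m i2 \<le> m i" for i using UNIV by blast
  fix e
  assume max: "\<forall>e'. weight m e' = weight m e \<longrightarrow> total_degree e' \<le> total_degree e"
  let ?l = Poly_Mapping.lookup
  show "\<forall>e'. weight m e' = weight m (e + Poly_Mapping.single i2 1) \<longrightarrow>
      total_degree e' \<le> total_degree (e + Poly_Mapping.single i2 1)"
  proof (intro allI impI, rule ccontr)
    fix e' assume wt: "weight m e' = weight m (e + Poly_Mapping.single i2 1)"
      and "\<not> total_degree e' \<le> total_degree (e + Poly_Mapping.single i2 1)"
    then have deg: "total_degree e + 1 < total_degree e'" by (simp add: total_degree_add total_degree_single)
    have "weight m e' = (a2 * ?l e i1 + a1 * (?l e i2 + 1)) * P + (a4 * ?l e i3 + a3 * ?l e i4) * Q"
      unfolding wt weight_add weight_single weight[of e] m by (simp add: algebra_simps)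
    then obtain r1 r2 r3 r4 where r: "(a2 * r1 + a1 * r2) * P + (a4 * r3 + a3 * r4) * Q = weight m e"
        "total_degree e < r1 + r2 + r3 + r4"
      using degree_exchange[OF cop le pos large, of "?l e' i1" "?l e' i2" "?l e' i3" "?l e' i4"
          "?l e i1" "?l e i2" "?l e i3" "?l e i4"] deg
      unfolding weight degree by blast
    define x where "x = Poly_Mapping.single i1 r1 + Poly_Mapping.single i2 r2 + Poly_Mapping.single i3 r3 + Poly_Mapping.single i4 r4"
    have "?l x i1 = r1" "?l x i2 = r2" "?l x i3 = r3" "?l x i4 = r4"
      using dist by (auto simp: x_def lookup_add lookup_single when_def)
    then have "weight m x = weight m e" "total_degree x > total_degree e"
      using r by (simp_all add: weight[of x] degree[of x])
    then show False using max by (metis not_le)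
  qed
qed

section \<open>Passage to the tangent cone\<close>

lemma coset_simps:
  fixes I :: "'a::comm_ring_1 set"
  assumes I: "ideal I ring_of_type_algebra"
  defines "R \<equiv> ring_of_type_algebra :: 'a ring"
  shows "carrier (R Quot I) = range (\<lambda>x. I +>\<^bsub>R\<^esub> x)"
    and "(I +>\<^bsub>R\<^esub> x) \<oplus>\<^bsub>R Quot I\<^esub> (I +>\<^bsub>R\<^esub> y) = I +>\<^bsub>R\<^esub> (x + y)"
    and "(I +>\<^bsub>R\<^esub> x) \<otimes>\<^bsub>R Quot I\<^esub> (I +>\<^bsub>R\<^esub> y) = I +>\<^bsub>R\<^esub> (x * y)"
    and "\<one>\<^bsub>R Quot I\<^esub> = I +>\<^bsub>R\<^esub> 1"
    and "\<zero>\<^bsub>R Quot I\<^esub> = I"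
    and "I +>\<^bsub>R\<^esub> x = I \<longleftrightarrow> x \<in> I"
    and "y \<in> I +>\<^bsub>R\<^esub> x \<longleftrightarrow> y - x \<in> I"
proof -
  interpret ideal I R unfolding R_def by (rule I)
  show carr: "carrier (R Quot I) = range (\<lambda>x. I +>\<^bsub>R\<^esub> x)"
    by (auto simp: FactRing_def A_RCOSETS_def' R_def)
  show "(I +>\<^bsub>R\<^esub> x) \<oplus>\<^bsub>R Quot I\<^esub> (I +>\<^bsub>R\<^esub> y) = I +>\<^bsub>R\<^esub> (x + y)"
    using ring_hom_add[OF rcos_ring_hom, of x y] by (simp add: R_def)
  show "(I +>\<^bsub>R\<^esub> x) \<otimes>\<^bsub>R Quot I\<^esub> (I +>\<^bsub>R\<^esub> y) = I +>\<^bsub>R\<^esub> (x * y)"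
    using ring_hom_mult[OF rcos_ring_hom, of x y] by (simp add: R_def)
  show "\<one>\<^bsub>R Quot I\<^esub> = I +>\<^bsub>R\<^esub> 1"
    using ring_hom_one[OF rcos_ring_hom] by (simp add: R_def)
  show "\<zero>\<^bsub>R Quot I\<^esub> = I" by (simp add: FactRing_def)
  show "I +>\<^bsub>R\<^esub> x = I \<longleftrightarrow> x \<in> I"
    using a_rcos_const[of x] rcos_const_imp_mem[of x] by (auto simp: R_def)
  show "y \<in> I +>\<^bsub>R\<^esub> x \<longleftrightarrow> y - x \<in> I"
    by (auto simp: a_r_coset_def' R_def intro: bexI[of _ "y - x"])
qed

text \<open>\<open>SOME\<close> picks a coset representative; as \<open>\<phi>\<close> vanishes on
  \<open>I\<close>, the choice is immaterial and the map is the one induced by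
  \<open>\<phi>\<close>.\<close>

lemma quotient_ring_over_polys:
  fixes I :: "'a::comm_ring_1 set" and \<phi> :: "'a \<Rightarrow> 'k::field poly"
  assumes I: "ideal I ring_of_type_algebra"
    and add: "\<And>x y. \<phi> (x + y) = \<phi> x + \<phi> y" and mult: "\<And>x y. \<phi> (x * y) = \<phi> x * \<phi> y"
    and one: "\<phi> 1 = 1" and surj: "\<And>p. \<exists>x. \<phi> x = p"
    and ker: "\<And>x. x \<in> I \<Longrightarrow> \<phi> x = 0" and nil: "\<And>x. \<phi> x = 0 \<Longrightarrow> \<exists>n. x ^ n \<in> I"
    and regular: "\<And>x y. \<phi> x \<noteq> 0 \<Longrightarrow> x * y \<in> I \<Longrightarrow> y \<in> I"
  shows "ring_over_polys (ring_of_type_algebra Quot I) (\<lambda>Z. \<phi> (SOME x. x \<in> Z))"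
proof -
  define R where "R = (ring_of_type_algebra :: 'a ring)"
  define \<psi> where "\<psi> = (\<lambda>Z. \<phi> (SOME x. x \<in> Z))"
  note simps = coset_simps[OF I, folded R_def]
  have psi: "\<psi> (I +>\<^bsub>R\<^esub> x) = \<phi> x" for x
  proof -
    have "x \<in> I +>\<^bsub>R\<^esub> x" using simps(7)[of x x] I by (simp add: ideal_type_algebra_iff)
    then have "(SOME y. y \<in> I +>\<^bsub>R\<^esub> x) - x \<in> I" using someI simps(7) by metis
    then have "\<phi> (((SOME y. y \<in> I +>\<^bsub>R\<^esub> x) - x) + x) = \<phi> x" unfolding add by (simp add: ker)
    then show ?thesis by (simp add: \<psi>_def)
  qed
  have pow: "(I +>\<^bsub>R\<^esub> x) [^]\<^bsub>R Quot I\<^esub> (n::nat) = I +>\<^bsub>R\<^esub> (x ^ n)" for x n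
    by (induction n) (simp_all add: simps nat_pow_def mult.commute)
  interpret cring "R Quot I"
    using ideal.quotient_is_cring[OF I cring_from_type_algebra] by (simp add: R_def)
  have "ring_over_polys (R Quot I) \<psi>"
  proof
    show "\<psi> (Z \<oplus>\<^bsub>R Quot I\<^esub> W) = \<psi> Z + \<psi> W" "\<psi> (Z \<otimes>\<^bsub>R Quot I\<^esub> W) = \<psi> Z * \<psi> W"
      if "Z \<in> carrier (R Quot I)" "W \<in> carrier (R Quot I)" for Z W
      using that by (auto simp: simps psi add mult)
    show "\<psi> \<one>\<^bsub>R Quot I\<^esub> = 1" by (simp add: simps psi one)
    show "\<exists>Z\<in>carrier (R Quot I). \<psi> Z = p" for p using surj[of p] by (auto simp: simps(1) psi)
    show "\<exists>n. Z [^]\<^bsub>R Quot I\<^esub> (n::nat) = \<zero>\<^bsub>R Quot I\<^esub>" if "Z \<in> carrier (R Quot I)" "\<psi> Z = 0" for Z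
      using that nil by (auto simp: simps(1,5,6) psi pow)
    show "W = \<zero>\<^bsub>R Quot I\<^esub>"
      if ZW: "Z \<in> carrier (R Quot I)" "W \<in> carrier (R Quot I)" "\<psi> Z \<noteq> 0" "Z \<otimes>\<^bsub>R Quot I\<^esub> W = \<zero>\<^bsub>R Quot I\<^esub>" for Z W
    proof -
      obtain x y where xy: "Z = I +>\<^bsub>R\<^esub> x" "W = I +>\<^bsub>R\<^esub> y" using ZW(1,2) by (auto simp: simps(1))
      then have "\<phi> x \<noteq> 0" "x * y \<in> I" using ZW(3,4) xy by (simp_all add: psi simps(3,5,6))
      then have "y \<in> I" by (rule regular)
      then show ?thesis using xy by (simp add: simps(5,6))
    qed
  qed
  then show ?thesis by (simp add: R_def \<psi>_def)
qed

text \<open>The condition on \<open>H\<close> expresses that \<open>J\<close> lies in the ideal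
  generated by \<open>A\<close> and \<open>I\<close>. Applied to the preimage of an ideal of the
  quotient, it makes the cosets of \<open>A\<close> generators.\<close>

lemma quotient_noetherian:
  fixes I :: "'a::comm_ring_1 set"
  assumes I: "ideal I ring_of_type_algebra"
    and fin: "\<And>J. ideal J ring_of_type_algebra \<Longrightarrow> \<exists>A. finite A \<and> A \<subseteq> J \<and>
      (\<forall>H. ideal H ring_of_type_algebra \<longrightarrow> I \<subseteq> H \<longrightarrow> A \<subseteq> H \<longrightarrow> J \<subseteq> H)"
  shows "noetherian_ring (ring_of_type_algebra Quot I)"
proof -
  define R where "R = (ring_of_type_algebra :: 'a ring)"
  note simps = coset_simps[OF I, folded R_def]
  interpret Q: cring "R Quot I"
    using ideal.quotient_is_cring[OF I cring_from_type_algebra] by (simp add: R_def)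
  have vimage: "ideal {x. I +>\<^bsub>R\<^esub> x \<in> L} (ring_of_type_algebra :: 'a ring)" if L: "ideal L (R Quot I)" for L
  proof -
    have zero: "I \<in> L" using additive_subgroup.zero_closed[OF ideal.axioms(1)[OF L]] by (simp add: simps(5))
    have "I +>\<^bsub>R\<^esub> 0 = I" using I by (simp add: simps(6) ideal_type_algebra_iff)
    moreover have "I +>\<^bsub>R\<^esub> (x + y) \<in> L" if "I +>\<^bsub>R\<^esub> x \<in> L" "I +>\<^bsub>R\<^esub> y \<in> L" for x y
      using additive_subgroup.a_closed[OF ideal.axioms(1)[OF L] that] by (simp add: simps(2))
    moreover have "I +>\<^bsub>R\<^esub> (x * y) \<in> L" if "I +>\<^bsub>R\<^esub> y \<in> L" for x y
      using ideal.I_l_closed[OF L that, of "I +>\<^bsub>R\<^esub> x"] by (simp add: simps(1,3))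
    ultimately show ?thesis unfolding ideal_type_algebra_iff using zero by simp
  qed
  have "noetherian_ring (R Quot I)"
  proof (intro noetherian_ring.intro noetherian_ring_axioms.intro Q.ring_axioms)
    fix J assume J: "ideal J (R Quot I)"
    obtain A where A: "finite A" "A \<subseteq> {x. I +>\<^bsub>R\<^esub> x \<in> J}"
      "\<And>H. ideal H ring_of_type_algebra \<Longrightarrow> I \<subseteq> H \<Longrightarrow> A \<subseteq> H \<Longrightarrow> {x. I +>\<^bsub>R\<^esub> x \<in> J} \<subseteq> H"
      using fin[OF vimage[OF J]] by blast
    define B where "B = (\<lambda>x. I +>\<^bsub>R\<^esub> x) ` A"
    define L where "L = genideal (R Quot I) B"
    have B: "B \<subseteq> carrier (R Quot I)" by (auto simp: B_def simps(1))
    have L: "ideal L (R Quot I)" "B \<subseteq> L"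
      unfolding L_def using Q.genideal_ideal[OF B] Q.genideal_self[OF B] by auto
    have "I \<in> L" using additive_subgroup.zero_closed[OF ideal.axioms(1)[OF L(1)]] by (simp add: simps(5))
    then have "{x. I +>\<^bsub>R\<^esub> x \<in> J} \<subseteq> {x. I +>\<^bsub>R\<^esub> x \<in> L}"
      using L(2) by (intro A(3) vimage L(1)) (auto simp: B_def simps(6)[THEN iffD2])
    moreover have "J \<subseteq> carrier (R Quot I)" using ideal.Icarr[OF J] by blast
    ultimately have "J \<subseteq> L" by (auto simp: simps(1))
    moreover have "L \<subseteq> J" unfolding L_def by (rule Q.genideal_minimal[OF J]) (use A(2) in \<open>auto simp: B_def\<close>)
    ultimately show "\<exists>A\<subseteq>carrier (R Quot I). finite A \<and> J = genideal (R Quot I) A"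
      using A(1) B by (intro exI[of _ B]) (auto simp: L_def B_def)
  qed
  then show ?thesis by (simp add: R_def)
qed

lemma (in stable_weights) cm_tangent_cone: "cm_tangent_cone TYPE('k::field) m"
proof -
  have I: "ideal (null_ideal :: 'k poly4 set) poly4_ring" by (rule null_ideal_ideal)
  have "noetherian_ring (poly4_ring Quot (null_ideal :: 'k poly4 set))"
  proof (rule quotient_noetherian[OF I])
    fix J :: "'k poly4 set" assume "ideal J poly4_ring"
    then show "\<exists>A. finite A \<and> A \<subseteq> J \<and> (\<forall>H. ideal H poly4_ring \<longrightarrow> null_ideal \<subseteq> H \<longrightarrow> A \<subseteq> H \<longrightarrow> J \<subseteq> H)"
      by (rule finitely_generated_mod_null_ideal) blast
  qed
  moreover have "ring_over_polys (poly4_ring Quot (null_ideal :: 'k poly4 set)) (\<lambda>Z. base (SOME x. x \<in> Z))"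
    by (rule quotient_ring_over_polys[OF I base_add base_mult base_one base_surj
        null_ideal_base null_ideal_nilpotent null_ideal_regular])
  ultimately show ?thesis
    unfolding cm_tangent_cone_def initial_ideal_eq by (intro ring_over_polys.cohen_macaulay)
qed

section \<open>The two families of curves\<close>

text \<open>\<open>n (i + 1)\<close> is a candidate, so the minimum exists; index arithmetic is
  modulo 4, hence \<open>i + 1\<close> differs from \<open>i\<close>.\<close>

lemma least_multiple_pos:
  assumes "\<And>i. n i > 0"
  shows "least_multiple n i > 0"
proof -
  let ?P = "\<lambda>a. a > 0 \<and> a * n i \<in> {\<Sum>j\<in>UNIV - {i}. c j * n j | c. True}"
  have "n (i + 1) * n i = (\<Sum>j\<in>UNIV - {i}. (if j = i + 1 then n i else 0) * n j)"
    by (simp add: if_distrib[of "\<lambda>x. x * _"] cong: if_cong)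
  then have "?P (n (i + 1))"
    using assms[of "i + 1"] by (intro conjI CollectI exI[of _ "\<lambda>j. if j = i + 1 then n i else 0"]) auto
  then show ?thesis unfolding least_multiple_def by (rule LeastI2[of ?P]) simp
qed

text \<open>Cancelling a common factor would produce a smaller admissible multiple.\<close>

lemma least_multiple_coprime:
  assumes pos: "\<And>i. n i > 0" and "i \<noteq> j" and eq: "least_multiple n i * n i = c * n j"
  shows "coprime (least_multiple n i) c"
proof -
  let ?P = "\<lambda>a. a > 0 \<and> a * n i \<in> {\<Sum>j\<in>UNIV - {i}. c j * n j | c. True}"
  define a g where "a = least_multiple n i" and "g = gcd a c"
  have "a > 0" unfolding a_def using pos by (rule least_multiple_pos)
  then have "g > 0" by (simp add: g_def)
  obtain a' c' where ac: "a = g * a'" "c = g * c'" by (metis dvdE gcd_dvd1 gcd_dvd2 g_def)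
  have "a' * n i = c' * n j" using eq ac \<open>g > 0\<close> by (simp add: a_def[symmetric] mult.assoc)
  also have "\<dots> = (\<Sum>k\<in>UNIV - {i}. (if k = j then c' else 0) * n k)"
    using \<open>i \<noteq> j\<close> by (simp add: if_distrib[of "\<lambda>x. x * _"] cong: if_cong)
  finally have "?P a'" using \<open>a > 0\<close> ac by auto
  then have "a \<le> a'" unfolding a_def least_multiple_def by (rule Least_le)
  then have "g = 1" using ac \<open>a > 0\<close> \<open>g > 0\<close> by simp
  then show ?thesis by (simp add: g_def a_def coprime_iff_gcd_eq_1)
qed

lemma toric_hom_Var_power: "toric_hom m (Var i ^ a :: 'k::comm_ring_1 poly4) = Polynomial.monom 1 (a * m i)"
proof (induction a)
  case 0
  then show ?case using toric_hom_const[of m "1 :: 'k"] by (simp add: monom_eq_1)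
next
  case (Suc a)
  then show ?case by (simp add: toric_hom_mult toric_hom_Var mult_monom)
qed

lemma binomial_in_toric_ideal:
  assumes "Var i ^ a - Var j ^ c \<in> (toric_ideal m :: 'k::field poly4 set)"
  shows "a * m i = c * m j"
  using assms
  by (simp add: toric_ideal_def toric_hom_eq_lin_ext lin_ext_diff)
     (simp add: toric_hom_eq_lin_ext[symmetric] toric_hom_Var_power monom_eq_iff')

lemma coprime_block:
  fixes a c x y :: nat
  assumes "coprime a c" "a * x = c * y" "c > 0"
  obtains P where "x = c * P" "y = a * P"
proof -
  have "c dvd a * x" using assms(2) by simp
  then have "c dvd x" using assms(1) by (metis coprime_commute coprime_dvd_mult_right_iff)
  then obtain P where P: "x = c * P" by (rule dvdE)
  then have "y = a * P" using assms(2,3) by (simp add: mult.left_commute)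
  then show ?thesis using P that by blast
qed

lemma cm_tangent_cone_two_blocks:
  fixes m :: "4 \<Rightarrow> nat"
  assumes m: "m 1 = a2 * P" "m 2 = a1 * P" "m 3 = a4 * Q" "m 4 = a3 * Q"
    and cop: "coprime a1 a2" "coprime P Q"
    and pos: "a1 > 0" "a2 > 0" "a3 > 0" "a4 > 0" "P > 0"
    and large: "(a1 + a2) * (a1 + a2 + a3 + a4 + P) \<le> Q"
  shows "cm_tangent_cone TYPE('k::field) m"
proof -
  have "a * (a' + c + P) \<le> (a1 + a2) * (a1 + a2 + a3 + a4 + P)"
    if "a \<le> a1 + a2" "a' \<le> a1 + a2" "c \<le> a3 + a4" for a a' c
    by (rule mult_le_mono) (use that in simp_all)
  then have Q: "a * (a' + c + P) \<le> Q" if "a \<le> a1 + a2" "a' \<le> a1 + a2" "c \<le> a3 + a4" for a a' c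
    using that large le_trans by blast
  \<comment> \<open>The bound \<open>large\<close> is symmetric under swapping entries within a
    block, so all four orderings reduce to one lemma.\<close>
  consider "a1 \<le> a2" "a4 \<le> a3" | "a1 \<le> a2" "a3 \<le> a4" | "a2 \<le> a1" "a4 \<le> a3" | "a2 \<le> a1" "a3 \<le> a4"
    by linarith
  then have "\<exists>b. stable_weights m b"
  proof cases
    case 1
    then show ?thesis
      using stable_weights_two_blocks[of 1 2 3 4 m a2 P a1 a4 Q a3] m cop pos Q[of a2 a1 a3] by auto
  next
    case 2
    then show ?thesis
      using stable_weights_two_blocks[of 1 2 4 3 m a2 P a1 a3 Q a4] m cop pos Q[of a2 a1 a4] by auto
  next
    case 3
    then show ?thesis
      using stable_weights_two_blocks[of 2 1 3 4 m a1 P a2 a4 Q a3] m cop pos Q[of a1 a2 a3]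
      by (auto simp: coprime_commute)
  next
    case 4
    then show ?thesis
      using stable_weights_two_blocks[of 2 1 4 3 m a1 P a2 a3 Q a4] m cop pos Q[of a1 a2 a4]
      by (auto simp: coprime_commute)
  qed
  then show ?thesis using stable_weights.cm_tangent_cone by blast
qed

theorem theorem2p9:
  fixes n a u d1 d2 :: "4 \<Rightarrow> nat"
    and f1 f2 f3 :: "'k::field poly4"
  assumes n_pos: "\<And>i. n i > 0"
    and n_gcd: "Gcd (range n) = 1"
    and a_def: "\<And>i. a i = least_multiple n i"
    and f1_def: "f1 = Var 1 ^ a 1 - Var 2 ^ a 2"
    and f2_def: "f2 = Var 3 ^ a 3 - Var 4 ^ a 4"
    and f3_def: "f3 = Var 1 ^ u 1 * Var 2 ^ u 2 - Var 3 ^ u 3 * Var 4 ^ u 4"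
    and ci: "complete_intersection (toric_ideal n :: 'k poly4 set)"
    and gen: "(toric_ideal n :: 'k poly4 set) = genideal poly4_ring {f1, f2, f3}"
    and d1_def: "d1 = (\<lambda>_. 0)(3 := a 2 * a 4, 4 := a 2 * a 3)"
    and d2_def: "d2 = (\<lambda>_. 0)(3 := a 1 * a 4, 4 := a 1 * a 3)"
  shows "\<exists>w0. \<forall>w\<ge>w0.
           (Gcd (range (\<lambda>i. n i + w * d1 i)) = 1 \<longrightarrow>
              cm_tangent_cone TYPE('k) (\<lambda>i. n i + w * d1 i)) \<and>
           (Gcd (range (\<lambda>i. n i + w * d2 i)) = 1 \<longrightarrow>
              cm_tangent_cone TYPE('k) (\<lambda>i. n i + w * d2 i))"
proof -
  interpret cring "poly4_ring :: 'k poly4 ring" by (rule cring_from_type_algebra)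
  have pos: "a i > 0" for i unfolding a_def by (rule least_multiple_pos[OF n_pos])
  \<comment> \<open>The weights of these binomials agree, and minimality of the \<open>a i\<close>
    makes the exponents coprime; this yields the block form of \<open>n\<close>.\<close>
  have "f1 \<in> toric_ideal n" "f2 \<in> toric_ideal n"
    unfolding gen using genideal_self[of "{f1, f2, f3}"] by auto
  then have eq: "a 1 * n 1 = a 2 * n 2" "a 3 * n 3 = a 4 * n 4"
    unfolding f1_def f2_def by (auto dest: binomial_in_toric_ideal)
  then have cop: "coprime (a 1) (a 2)" "coprime (a 3) (a 4)"
    using least_multiple_coprime[where n = n and i = 1 and j = 2] least_multiple_coprime[where n = n and i = 3 and j = 4] n_pos
    by (simp_all add: a_def)
  obtain P where P: "n 1 = a 2 * P" "n 2 = a 1 * P" using coprime_block[OF cop(1) eq(1) pos] .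
  obtain Q where Q: "n 3 = a 4 * Q" "n 4 = a 3 * Q" using coprime_block[OF cop(2) eq(2) pos] .
  have "P > 0" using n_pos[of 1] P by simp
  \<comment> \<open>Both families at once: \<open>k = a 2\<close> for \<open>d1\<close> and
    \<open>k = a 1\<close> for \<open>d2\<close>. Adding \<open>w * d\<close> keeps \<open>P\<close>
    and replaces \<open>Q\<close> by \<open>Q + w * k\<close>; the lower bound on \<open>w\<close>
    serves as \<open>w0\<close>.\<close>
  have cone: "cm_tangent_cone TYPE('k) (\<lambda>i. n i + w * d i)"
    if w: "(a 1 + a 2) * (a 1 + a 2 + a 3 + a 4 + P) \<le> w" and "k > 0"
      and d: "d = (\<lambda>_. 0)(3 := k * a 4, 4 := k * a 3)" and gcd: "Gcd (range (\<lambda>i. n i + w * d i)) = 1"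
    for w k d
  proof -
    let ?m = "\<lambda>i. n i + w * d i"
    have m: "?m 1 = a 2 * P" "?m 2 = a 1 * P" "?m 3 = a 4 * (Q + w * k)" "?m 4 = a 3 * (Q + w * k)"
      by (simp_all add: d P Q algebra_simps)
    \<comment> \<open>A common divisor would divide all four entries.\<close>
    have "coprime P (Q + w * k)"
    proof (rule coprimeI)
      fix c assume c: "c dvd P" "c dvd Q + w * k"
      have "\<forall>i. c dvd ?m i" unfolding forall_4 m using c by simp
      then have "c dvd Gcd (range ?m)" by (intro Gcd_greatest) auto
      then show "is_unit c" using gcd by simp
    qed
    moreover have "w \<le> w * k" using \<open>k > 0\<close> by simp
    then have "(a 1 + a 2) * (a 1 + a 2 + a 3 + a 4 + P) \<le> Q + w * k" using w by linarith
    ultimately show ?thesis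
      by (intro cm_tangent_cone_two_blocks[OF m cop(1)] pos \<open>P > 0\<close>)
  qed
  show ?thesis
    using cone[OF _ pos d1_def] cone[OF _ pos d2_def] by blast
qed

end
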